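(* Let $n$ be a positive integer, $k$ a non-negative integer, and $\mathbf{1}=(1,\ldots,1)$ (with $n+k$ entries, the number of variables of $\mathcal{A}_{n+1,k}$). Then \begin{align*} \mathcal{A}_{n+1,0}(r,1,1,t;\mathbf{1})&=\mathrm{CSSPP}_{n,0}(r,t+2),\\ \mathcal{A}_{n+1,k}(r,1,1,-1;\mathbf{1})&=\mathrm{CSSPP}_{n,2k}(r,1),\\ \mathcal{A}_{n+1,k}(r,1,1,0;\mathbf{1})&=\mathrm{CSSPP}_{n,k}(r,2). \end{align*}
   Context: Partitions: a partition is a weakly decreasing sequence of non-negative integers; $\lambda'$ is the conjugate. If $l=\max\{i:\lambda_i\ge i\}$, the Frobenius notation of $\lambda$ is $(a_1,\ldots,a_l\mid b_1,\ldots,b_l)$ with $a_i=\lambda_i-i$, $b_i=\lambda'_i-i$; such a symbol (with strictly decreasing non-negative $a$'s and $b$'s) determines a partition. $s_\lambda(\mathbf{x})$ is the Schur polynomial. $\mathrm{TSPP}_m$ is the set of arrays $T=(T_{i,j})_{1\le i,j\le m}$ of integers in $\{0,\ldots,m\}$ with weakly decreasing rows and columns such that $\{(i,j,c):1\le c\le T_{i,j}\}\subseteq[m]^3$ is invariant under all permutations of coordinates. For $T$, let $\mathrm{diag}(T)$ be the conjugate of $(T_{1,1},\ldots,T_{m,m})$ with Frobenius notation $(a_1,\ldots,a_l\mid b_1,\ldots,b_l)$, and $\pi_k(T)$ the partition with Frobenius notation $(a_1,\ldots,a_l\mid b_1+k,\ldots,b_l+k)$. For $T\in\mathrm{TSPP}_{N-1}$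 set $\omega(T)=r^lu^{\sum_i(a_i+1)}v^{\binom{N}{2}-\sum_i(b_i+1)}w^{\sum_i(b_i-a_i)}$ and $\mathcal{A}_{N,k}(r,u,v,w;\mathbf{x})=\sum_{T\in\mathrm{TSPP}_{N-1}}\omega(T)s_{\pi_k(T)}(x_1,\ldots,x_{N+k-1})$. Column strict shifted plane partitions: for a strict partition $\lambda=(\lambda_1>\dots>\lambda_m>0)$, the shifted diagram has cells $(i,j)$ with $1\le i\le m$, $i\le j\le i+\lambda_i-1$. A CSSPP is a filling $\pi=(\pi_{i,j})$ of such a diagram with positive integers, weakly decreasing along rows and strictly decreasing down columns ($\pi_{i,j}>\pi_{i+1,j}$). It is of class $k$ if $\pi_{i,i}=\lambda_i+k$ for every row $i$. Let $\rho(\pi)$ be the number of rows and $\mu(\pi)$ the number of cells $(i,j)$ with $\pi_{i,j}\le k+j-i$. Then $\mathrm{CSSPP}_{n,k}(r,t)=\sum_\pi r^{\rho(\pi)}t^{\mu(\pi)}$, summed over all CSSPPs of class $k$ whose first row has at most $n$ entries (including the empty one). *)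

theory Defs
  imports Main
begin

section \<open>Partitions and Frobenius notation\<close>

text \<open>Partitions are functions indexed from 1, with finite support. The value at the unused index 0
  is fixed to be 0, so that equality of partitions is equality of functions.\<close>

definition is_partition :: "(nat \<Rightarrow> nat) \<Rightarrow> bool" where
  "is_partition p \<longleftrightarrow> p 0 = 0 \<and> (\<forall>i\<ge>1. p (Suc i) \<le> p i) \<and> finite {i. p i \<noteq> 0}"

definition conjugate :: "(nat \<Rightarrow> nat) \<Rightarrow> nat \<Rightarrow> nat" where
  "conjugate p j = (if j = 0 then 0 else card {i. 1 \<le> i \<and> j \<le> p i})"

text \<open>The index 0 always belongs to the set below, so the maximum exists and
  the empty partition gets the value 0.\<close>

definition durfee :: "(nat \<Rightarrow> nat) \<Rightarrow> nat" where
  "durfee p = Max {i. i \<le> p i}"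

definition frobenius :: "(nat \<Rightarrow> nat) \<Rightarrow> nat list \<times> nat list" where
  "frobenius p =
     (map (\<lambda>i. p i - i) [1..<Suc (durfee p)],
      map (\<lambda>i. conjugate p i - i) [1..<Suc (durfee p)])"

definition of_frobenius :: "nat list \<Rightarrow> nat list \<Rightarrow> nat \<Rightarrow> nat" where
  "of_frobenius as bs = (THE p. is_partition p \<and> frobenius p = (as, bs))"

section \<open>Schur polynomials\<close>

definition diagram :: "(nat \<Rightarrow> nat) \<Rightarrow> (nat \<times> nat) set" where
  "diagram p = {(i, j). 1 \<le> i \<and> 1 \<le> j \<and> j \<le> p i}"

text \<open>Fillings are 0 outside the diagram, so that distinct functions are distinct tableaux.\<close>

definition SSYT :: "(nat \<Rightarrow> nat) \<Rightarrow> nat \<Rightarrow> (nat \<Rightarrow> nat \<Rightarrow> nat) set" where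
  "SSYT p n = {F.
     (\<forall>i j. (i, j) \<in> diagram p \<longrightarrow> 1 \<le> F i j \<and> F i j \<le> n) \<and>
     (\<forall>i j. (i, j) \<notin> diagram p \<longrightarrow> F i j = 0) \<and>
     (\<forall>i j. (i, j) \<in> diagram p \<and> (i, Suc j) \<in> diagram p \<longrightarrow> F i j \<le> F i (Suc j)) \<and>
     (\<forall>i j. (i, j) \<in> diagram p \<and> (Suc i, j) \<in> diagram p \<longrightarrow> F i j < F (Suc i) j)}"

text \<open>The Schur polynomial of shape \<open>p\<close> evaluated at \<open>x 1, \<dots>, x n\<close>.\<close>

definition schur :: "(nat \<Rightarrow> nat) \<Rightarrow> nat \<Rightarrow> (nat \<Rightarrow> 'a::comm_ring_1) \<Rightarrow> 'a" where
  "schur p n x = (\<Sum>F\<in>SSYT p n. \<Prod>(i, j)\<in>diagram p. x (F i j))"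

section \<open>Totally symmetric plane partitions\<close>

definition plane_cells :: "nat \<Rightarrow> (nat \<Rightarrow> nat \<Rightarrow> nat) \<Rightarrow> (nat \<times> nat \<times> nat) set" where
  "plane_cells m T =
     {(i, j, c). 1 \<le> i \<and> i \<le> m \<and> 1 \<le> j \<and> j \<le> m \<and> 1 \<le> c \<and> c \<le> T i j}"

text \<open>Arrays are extended by 0 outside \<open>{1..m} \<times> {1..m}\<close>. The last condition lists the five
  non-identity permutations of the coordinates.\<close>

definition TSPP :: "nat \<Rightarrow> (nat \<Rightarrow> nat \<Rightarrow> nat) set" where
  "TSPP m = {T.
     (\<forall>i j. \<not> (1 \<le> i \<and> i \<le> m \<and> 1 \<le> j \<and> j \<le> m) \<longrightarrow> T i j = 0) \<and>
     (\<forall>i j. T i j \<le> m) \<and>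
     (\<forall>i\<in>{1..m}. \<forall>j\<in>{1..<m}. T i (Suc j) \<le> T i j) \<and>
     (\<forall>i\<in>{1..<m}. \<forall>j\<in>{1..m}. T (Suc i) j \<le> T i j) \<and>
     (\<forall>i j c. (i, j, c) \<in> plane_cells m T \<longrightarrow>
        (i, c, j) \<in> plane_cells m T \<and> (j, i, c) \<in> plane_cells m T \<and>
        (j, c, i) \<in> plane_cells m T \<and> (c, i, j) \<in> plane_cells m T \<and>
        (c, j, i) \<in> plane_cells m T)}"

definition tspp_diag :: "(nat \<Rightarrow> nat \<Rightarrow> nat) \<Rightarrow> nat \<Rightarrow> nat" where
  "tspp_diag T = conjugate (\<lambda>i. T i i)"

definition tspp_pi :: "nat \<Rightarrow> (nat \<Rightarrow> nat \<Rightarrow> nat) \<Rightarrow> nat \<Rightarrow> nat" where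
  "tspp_pi k T = (case frobenius (tspp_diag T) of (as, bs) \<Rightarrow> of_frobenius as (map (\<lambda>b. b + k) bs))"

text \<open>The subtractions of natural numbers in the exponents do not truncate for \<open>T \<in> TSPP (N - 1)\<close>;
  see \<open>TSPP_frobenius_le\<close> and \<open>TSPP_frobenius_sum_le\<close> below.\<close>

definition tspp_weight ::
    "nat \<Rightarrow> 'a::comm_ring_1 \<Rightarrow> 'a \<Rightarrow> 'a \<Rightarrow> 'a \<Rightarrow> (nat \<Rightarrow> nat \<Rightarrow> nat) \<Rightarrow> 'a" where
  "tspp_weight N r u v w T = (case frobenius (tspp_diag T) of (as, bs) \<Rightarrow>
     r ^ length as
     * u ^ (\<Sum>a\<leftarrow>as. a + 1)
     * v ^ ((N choose 2) - (\<Sum>b\<leftarrow>bs. b + 1))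
     * w ^ (\<Sum>(a, b)\<leftarrow>zip as bs. b - a))"

definition tspp_gf ::
    "nat \<Rightarrow> nat \<Rightarrow> 'a::comm_ring_1 \<Rightarrow> 'a \<Rightarrow> 'a \<Rightarrow> 'a \<Rightarrow> (nat \<Rightarrow> 'a) \<Rightarrow> 'a" where
  "tspp_gf N k r u v w x =
     (\<Sum>T\<in>TSPP (N - 1). tspp_weight N r u v w T * schur (tspp_pi k T) (N + k - 1) x)"

section \<open>Column strict shifted plane partitions\<close>

definition strict_partition :: "(nat \<Rightarrow> nat) \<Rightarrow> bool" where
  "strict_partition p \<longleftrightarrow> is_partition p \<and> (\<forall>i\<ge>1. p i > 0 \<longrightarrow> p (Suc i) < p i)"

definition shifted_diagram :: "(nat \<Rightarrow> nat) \<Rightarrow> (nat \<times> nat) set" where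
  "shifted_diagram p = {(i, j). 1 \<le> i \<and> i \<le> j \<and> j < i + p i}"

text \<open>A column strict shifted plane partition is a pair of its shape and its filling;
  the filling is 0 outside the shifted diagram.\<close>

definition is_csspp :: "(nat \<Rightarrow> nat) \<Rightarrow> (nat \<Rightarrow> nat \<Rightarrow> nat) \<Rightarrow> bool" where
  "is_csspp p F \<longleftrightarrow>
     strict_partition p \<and>
     (\<forall>i j. (i, j) \<in> shifted_diagram p \<longrightarrow> F i j > 0) \<and>
     (\<forall>i j. (i, j) \<notin> shifted_diagram p \<longrightarrow> F i j = 0) \<and>
     (\<forall>i j. (i, j) \<in> shifted_diagram p \<and> (i, Suc j) \<in> shifted_diagram p
        \<longrightarrow> F i (Suc j) \<le> F i j) \<and>
     (\<forall>i j. (i, j) \<in> shifted_diagram p \<and> (Suc i, j) \<in> shifted_diagram p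
        \<longrightarrow> F (Suc i) j < F i j)"

definition csspp_rows :: "(nat \<Rightarrow> nat) \<Rightarrow> nat" where
  "csspp_rows p = card {i. p i > 0}"

definition CSSPP :: "nat \<Rightarrow> nat \<Rightarrow> ((nat \<Rightarrow> nat) \<times> (nat \<Rightarrow> nat \<Rightarrow> nat)) set" where
  "CSSPP n k = {(p, F). is_csspp p F \<and> (\<forall>i. p i > 0 \<longrightarrow> F i i = p i + k) \<and> p 1 \<le> n}"

definition csspp_mu :: "nat \<Rightarrow> (nat \<Rightarrow> nat) \<Rightarrow> (nat \<Rightarrow> nat \<Rightarrow> nat) \<Rightarrow> nat" where
  "csspp_mu k p F = card {(i, j) \<in> shifted_diagram p. F i j \<le> k + j - i}"

definition csspp_gf :: "nat \<Rightarrow> nat \<Rightarrow> 'a::comm_ring_1 \<Rightarrow> 'a \<Rightarrow> 'a" where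
  "csspp_gf n k r t = (\<Sum>(p, F)\<in>CSSPP n k. r ^ csspp_rows p * t ^ csspp_mu k p F)"

section \<open>Well-definedness\<close>

lemma partition_antimono:
  assumes "is_partition p" "1 \<le> i" "i \<le> j"
  shows "p j \<le> p i"
  using assms(3)
proof (induction j rule: dec_induct)
  case (step j)
  then have "p (Suc j) \<le> p j" using assms unfolding is_partition_def by auto
  then show ?case using step by simp
qed simp

lemma finite_le_partition:
  assumes "is_partition p" "1 \<le> j"
  shows "finite {i. 1 \<le> i \<and> j \<le> p i}"
proof -
  have "{i. 1 \<le> i \<and> j \<le> p i} \<subseteq> {i. p i \<noteq> 0}" using assms(2) by auto
  then show ?thesis using assms(1) finite_subset unfolding is_partition_def by blast
qed

lemma le_conjugate_iff:
  assumes "is_partition p" "1 \<le> i" "1 \<le> j"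
  shows "i \<le> conjugate p j \<longleftrightarrow> j \<le> p i"
proof -
  let ?S = "{i. 1 \<le> i \<and> j \<le> p i}"
  have fin: "finite ?S" using finite_le_partition assms by blast
  have c: "conjugate p j = card ?S" using assms unfolding conjugate_def by auto
  show ?thesis
  proof
    assume "j \<le> p i"
    then have "{1..i} \<subseteq> ?S"
      using partition_antimono[OF assms(1), of _ i] by fastforce
    then have "card {1..i} \<le> card ?S" by (rule card_mono[OF fin])
    then show "i \<le> conjugate p j" using c by simp
  next
    assume i: "i \<le> conjugate p j"
    show "j \<le> p i"
    proof (rule ccontr)
      assume n: "\<not> j \<le> p i"
      have "?S \<subseteq> {1..<i}"
      proof
        fix x assume x: "x \<in> ?S"
        have "\<not> i \<le> x" using partition_antimono[OF assms(1,2), of x] x n by auto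
        then show "x \<in> {1..<i}" using x by auto
      qed
      then have "card ?S \<le> card {1..<i}" by (intro card_mono) auto
      then show False using i c assms by simp
    qed
  qed
qed

lemma partition_conjugate:
  assumes "is_partition p"
  shows "is_partition (conjugate p)"
proof -
  have 1: "conjugate p (Suc i) \<le> conjugate p i" if "1 \<le> i" for i
  proof (cases "conjugate p (Suc i) = 0")
    case False
    then have "Suc i \<le> p (conjugate p (Suc i))"
      using le_conjugate_iff[OF assms, of "conjugate p (Suc i)" "Suc i"] by auto
    then show ?thesis
      using le_conjugate_iff[OF assms, of "conjugate p (Suc i)" i] that False by auto
  qed simp
  have "{i. conjugate p i \<noteq> 0} \<subseteq> {..p 1}"
  proof
    fix j assume j: "j \<in> {i. conjugate p i \<noteq> 0}"
    then have "1 \<le> j" by (cases "j = 0") (simp_all add: conjugate_def)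
    moreover from j have "1 \<le> conjugate p j" by simp
    ultimately show "j \<in> {..p 1}" using le_conjugate_iff[OF assms, of 1 j] by simp
  qed
  then have "finite {i. conjugate p i \<noteq> 0}" using finite_subset by blast
  then show ?thesis using 1 unfolding is_partition_def by (simp add: conjugate_def)
qed

lemma le_durfee_iff:
  assumes "is_partition p"
  shows "i \<le> durfee p \<longleftrightarrow> i \<le> p i"
proof -
  let ?S = "{i. i \<le> p i}"
  have "?S \<subseteq> insert 0 {i. p i \<noteq> 0}" by auto
  then have fin: "finite ?S"
    using assms finite_subset unfolding is_partition_def by blast
  have "durfee p \<in> ?S" unfolding durfee_def by (rule Max_in[OF fin]) auto
  then have d: "durfee p \<le> p (durfee p)" by simp
  show ?thesis
  proof
    assume "i \<le> durfee p"
    then show "i \<le> p i" using partition_antimono[OF assms, of i "durfee p"] d by (cases "i = 0") auto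
  next
    assume "i \<le> p i"
    then show "i \<le> durfee p" unfolding durfee_def using Max_ge[OF fin] by simp
  qed
qed

lemma frobenius_strict:
  assumes "is_partition p" "frobenius p = (as, bs)"
  shows "length as = length bs" "sorted_wrt (>) as" "sorted_wrt (>) bs"
proof -
  have as: "as = map (\<lambda>i. p i - i) [1..<Suc (durfee p)]"
    and bs: "bs = map (\<lambda>i. conjugate p i - i) [1..<Suc (durfee p)]"
    using assms(2) unfolding frobenius_def by auto
  show "length as = length bs" using as bs by simp
  have "p j - j < p i - i" if "i < j" "1 \<le> i" "j \<le> durfee p" for i j
    using partition_antimono[OF assms(1), of i j] le_durfee_iff[OF assms(1), of j] that by auto
  then show "sorted_wrt (>) as" unfolding as sorted_wrt_iff_nth_less by (auto simp del: upt_Suc)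
  have "conjugate p j - j < conjugate p i - i" if "i < j" "1 \<le> i" "j \<le> durfee p" for i j
    using partition_antimono[OF partition_conjugate[OF assms(1)], of i j]
      le_durfee_iff[OF assms(1), of j] le_conjugate_iff[OF assms(1), of j j] that by auto
  then show "sorted_wrt (>) bs" unfolding bs sorted_wrt_iff_nth_less by (auto simp del: upt_Suc)
qed

lemma frobenius_inj:
  assumes p: "is_partition p" and q: "is_partition q" and eq: "frobenius p = frobenius q"
  shows "p = q"
proof -
  define l where "l = durfee p"
  have l: "durfee q = l"
    using arg_cong[OF eq, of "\<lambda>x. length (fst x)"] unfolding frobenius_def l_def by (simp del: upt_Suc)
  have a: "p i = q i \<and> conjugate p i = conjugate q i" if "1 \<le> i" "i \<le> l" for i
  proof -
    have "p i - i = q i - i" "conjugate p i - i = conjugate q i - i"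
      using arg_cong[OF eq, of "\<lambda>x. fst x ! (i - 1)"] arg_cong[OF eq, of "\<lambda>x. snd x ! (i - 1)"]
        that l unfolding frobenius_def l_def[symmetric] by (auto simp del: upt_Suc)
    moreover have "i \<le> p i" "i \<le> q i"
      using le_durfee_iff[OF p, of i] le_durfee_iff[OF q, of i] that l l_def by simp_all
    moreover from this have "i \<le> conjugate p i" "i \<le> conjugate q i"
      using le_conjugate_iff p q that by auto
    ultimately show ?thesis by auto
  qed
  have le: "x i \<le> y i" if "is_partition x" "is_partition y" "durfee x = l" "1 \<le> i" "l < i"
     "\<And>c. 1 \<le> c \<Longrightarrow> c \<le> l \<Longrightarrow> conjugate x c = conjugate y c" for x y i
  proof (cases "x i = 0")
    case False
    have "x i \<le> l"
    proof (rule ccontr)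
      assume "\<not> x i \<le> l"
      then have "Suc l \<le> x (Suc l)" using partition_antimono[OF that(1), of "Suc l" i] that by auto
      then show False using le_durfee_iff[OF that(1), of "Suc l"] that by simp
    qed
    then have "i \<le> conjugate y (x i)"
      using le_conjugate_iff[OF that(1), of i "x i"] that(4) that(6)[of "x i"] False by auto
    then show ?thesis using le_conjugate_iff[OF that(2), of i "x i"] that(4) False by auto
  qed simp
  show ?thesis
  proof
    fix i
    consider "i = 0" | "1 \<le> i" "i \<le> l" | "1 \<le> i" "l < i" by linarith
    then show "p i = q i"
    proof cases
      case 1
      then show ?thesis using p q unfolding is_partition_def by simp
    next
      case 2
      then show ?thesis using a by simp
    next
      case 3
      show ?thesis using le[OF p q _ 3] le[OF q p l 3] a l_def by (simp add: order_antisym)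
    qed
  qed
qed

lemma frobenius_ex:
  assumes "length as = length bs" "sorted_wrt (>) as" "sorted_wrt (>) bs"
  shows "\<exists>p. is_partition p \<and> frobenius p = (as, bs)"
proof -
  define l where "l = length as"
  define L where "L i = {j. 1 \<le> j \<and> j \<le> l \<and> i \<le> bs ! (j - 1) + j}" for i
  define p where "p i = (if i = 0 then 0 else if i \<le> l then as ! (i - 1) + i else card (L i))" for i
  have finL: "finite (L i)" for i
    by (rule finite_subset[of _ "{..l}"]) (auto simp: L_def)
  have Lle: "card (L i) \<le> l" for i
  proof -
    have "L i \<subseteq> {1..l}" by (auto simp: L_def)
    then have "card (L i) \<le> card {1..l}" by (intro card_mono) auto
    then show ?thesis by simp
  qed
  have gap: "i \<le> j \<Longrightarrow> j < length xs \<Longrightarrow> xs ! j + j \<le> xs ! i + i"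
    if "sorted_wrt (>) xs" for xs :: "nat list" and i j
  proof (induction j rule: dec_induct)
    case (step n)
    then show ?case using that sorted_wrt_nth_less[OF that, of n "Suc n"] by simp
  qed simp
  have gb: "bs ! (j - 1) + j \<le> bs ! (i - 1) + i" if "1 \<le> i" "i \<le> j" "j \<le> l" for i j
    using gap[OF assms(3), of "i - 1" "j - 1"] that assms(1) l_def by (cases i; cases j) auto
  have ga: "as ! (j - 1) + j \<le> as ! (i - 1) + i" if "1 \<le> i" "i \<le> j" "j \<le> l" for i j
    using gap[OF assms(2), of "i - 1" "j - 1"] that assms(1) l_def by (cases i; cases j) auto
  have mono: "p (Suc i) \<le> p i" if i: "1 \<le> i" for i
  proof -
    consider "Suc i \<le> l" | "i = l" | "l < i" by linarith
    then show ?thesis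
    proof cases
      case 1
      then show ?thesis using ga[of i "Suc i"] i by (simp add: p_def)
    next
      case 2
      then show ?thesis using Lle[of "Suc i"] i by (simp add: p_def)
    next
      case 3
      have "card (L (Suc i)) \<le> card (L i)" by (rule card_mono[OF finL]) (auto simp: L_def)
      then show ?thesis using 3 by (simp add: p_def)
    qed
  qed
  have "{i. p i \<noteq> 0} \<subseteq> {..l + bs ! 0 + 1}"
  proof
    fix i assume i: "i \<in> {i. p i \<noteq> 0}"
    show "i \<in> {..l + bs ! 0 + 1}"
    proof (cases "i \<le> l")
      case False
      then have "L i \<noteq> {}" using i by (auto simp: p_def)
      then obtain j where j: "1 \<le> j" "j \<le> l" "i \<le> bs ! (j - 1) + j" unfolding L_def by auto
      then show ?thesis using gb[of 1 j] by simp
    qed simp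
  qed
  then have fin: "finite {i. p i \<noteq> 0}" using finite_subset by blast
  have part: "is_partition p" using mono fin unfolding is_partition_def by (simp add: p_def)
  have "\<not> Suc l \<le> p (Suc l)" using Lle[of "Suc l"] by (simp add: p_def)
  moreover have "l \<le> p l" by (simp add: p_def)
  ultimately have dur: "durfee p = l"
    using le_durfee_iff[OF part, of l] le_durfee_iff[OF part, of "Suc l"] by linarith
  have cj: "conjugate p j = bs ! (j - 1) + j" if j: "1 \<le> j" "j \<le> l" for j
  proof -
    have iff: "j \<le> p i \<longleftrightarrow> i \<le> bs ! (j - 1) + j" if i: "1 \<le> i" for i
    proof (cases "i \<le> l")
      case True
      have "j \<le> p l" using \<open>l \<le> p l\<close> j by simp
      then have "j \<le> p i" using partition_antimono[OF part i True] by simp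
      moreover have "i \<le> bs ! (j - 1) + j" using gb[of j l] j True by simp
      ultimately show ?thesis by simp
    next
      case False
      then have pi: "p i = card (L i)" by (simp add: p_def)
      show ?thesis
      proof
        assume "i \<le> bs ! (j - 1) + j"
        then have "{1..j} \<subseteq> L i" using gb j by (fastforce simp: L_def)
        then have "card {1..j} \<le> card (L i)" by (rule card_mono[OF finL])
        then show "j \<le> p i" using pi by simp
      next
        assume a: "j \<le> p i"
        show "i \<le> bs ! (j - 1) + j"
        proof (rule ccontr)
          assume n: "\<not> i \<le> bs ! (j - 1) + j"
          have "L i \<subseteq> {1..<j}"
          proof
            fix x assume x: "x \<in> L i"
            have "\<not> j \<le> x" using gb[of j x] x n j by (auto simp: L_def)
            then show "x \<in> {1..<j}" using x by (auto simp: L_def)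
          qed
          then have "card (L i) \<le> card {1..<j}" by (intro card_mono) auto
          then show False using a pi j by simp
        qed
      qed
    qed
    have "{i. 1 \<le> i \<and> j \<le> p i} = {1..bs ! (j - 1) + j}" using iff by auto
    then show ?thesis using j by (simp add: conjugate_def)
  qed
  have "map (\<lambda>i. p i - i) [1..<Suc (durfee p)] = as"
    by (rule nth_equalityI) (auto simp: dur p_def l_def simp del: upt_Suc)
  moreover have "map (\<lambda>i. conjugate p i - i) [1..<Suc (durfee p)] = bs"
    by (rule nth_equalityI) (auto simp: dur cj l_def assms(1) simp del: upt_Suc)
  ultimately show ?thesis using part unfolding frobenius_def by auto
qed

lemma of_frobenius:
  assumes "length as = length bs" "sorted_wrt (>) as" "sorted_wrt (>) bs"
  shows "is_partition (of_frobenius as bs)" "frobenius (of_frobenius as bs) = (as, bs)"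
proof -
  have "\<exists>!p. is_partition p \<and> frobenius p = (as, bs)"
    using frobenius_ex[OF assms] frobenius_inj by metis
  from theI'[OF this]
  show "is_partition (of_frobenius as bs)" "frobenius (of_frobenius as bs) = (as, bs)"
    unfolding of_frobenius_def by auto
qed

lemma TSPP_diagonal_partition:
  assumes "T \<in> TSPP m"
  shows "is_partition (\<lambda>i. T i i)"
proof -
  have z: "T i j = 0" if "\<not> (1 \<le> i \<and> i \<le> m \<and> 1 \<le> j \<and> j \<le> m)" for i j
    using assms that unfolding TSPP_def by blast
  have "T (Suc i) (Suc i) \<le> T i i" if i: "1 \<le> i" for i
  proof (cases "Suc i \<le> m")
    case True
    have r: "\<forall>i\<in>{1..m}. \<forall>j\<in>{1..<m}. T i (Suc j) \<le> T i j"
      and c: "\<forall>i\<in>{1..<m}. \<forall>j\<in>{1..m}. T (Suc i) j \<le> T i j"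
      using assms unfolding TSPP_def by blast+
    have "T (Suc i) (Suc i) \<le> T i (Suc i)" using c i True by auto
    also have "\<dots> \<le> T i i" using r i True by auto
    finally show ?thesis .
  qed (use z in auto)
  moreover have "{i. T i i \<noteq> 0} \<subseteq> {..m}"
  proof
    fix i assume "i \<in> {i. T i i \<noteq> 0}"
    then show "i \<in> {..m}" using z[of i i] by auto
  qed
  then have "finite {i. T i i \<noteq> 0}" using finite_subset by blast
  ultimately show ?thesis using z unfolding is_partition_def by auto
qed

lemma partition_tspp_diag: "T \<in> TSPP m \<Longrightarrow> is_partition (tspp_diag T)"
  unfolding tspp_diag_def by (intro partition_conjugate TSPP_diagonal_partition)

lemma partition_eqI:
  assumes "is_partition p" "is_partition q" "\<And>i j. 1 \<le> i \<Longrightarrow> 1 \<le> j \<Longrightarrow> j \<le> p i \<longleftrightarrow> j \<le> q i"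
  shows "p = q"
proof
  fix i show "p i = q i"
  proof (cases "i = 0")
    case True
    then show ?thesis using assms unfolding is_partition_def by simp
  next
    case False
    then show ?thesis using assms(3)[of i "p i"] assms(3)[of i "q i"]
      by (cases "p i = 0"; cases "q i = 0") auto
  qed
qed

lemma conjugate_conjugate: "is_partition p \<Longrightarrow> conjugate (conjugate p) = p"
  by (rule partition_eqI) (simp_all add: partition_conjugate le_conjugate_iff)

lemma TSPP_frobenius_le:
  assumes "T \<in> TSPP m" "frobenius (tspp_diag T) = (as, bs)"
  shows "list_all2 (\<le>) as bs"
proof -
  let ?d = "\<lambda>i. T i i" and ?p = "tspp_diag T"
  have d: "is_partition ?d" by (rule TSPP_diagonal_partition[OF assms(1)])
  have p: "is_partition ?p" by (rule partition_tspp_diag[OF assms(1)])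
  have cp: "conjugate ?p = ?d" unfolding tspp_diag_def by (rule conjugate_conjugate[OF d])
  have main: "?p i \<le> T i i" if i: "1 \<le> i" "i \<le> durfee ?p" for i
  proof -
    define j where "j = ?p i"
    have ij: "i \<le> j" using le_durfee_iff[OF p, of i] i j_def by simp
    then have Tj: "i \<le> T j j"
      using le_conjugate_iff[OF d, of j i] i unfolding j_def tspp_diag_def by auto
    have z: "T a b = 0" if "\<not> (1 \<le> a \<and> a \<le> m \<and> 1 \<le> b \<and> b \<le> m)" for a b
      using assms(1) that unfolding TSPP_def by blast
    have jm: "j \<le> m" using z[of j j] Tj i by fastforce
    have "(j, j, i) \<in> plane_cells m T" using Tj i ij jm unfolding plane_cells_def by auto
    then have "(i, j, j) \<in> plane_cells m T" using assms(1) unfolding TSPP_def by blast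
    then have 1: "j \<le> T i j" unfolding plane_cells_def by auto
    have r: "\<forall>i\<in>{1..m}. \<forall>j\<in>{1..<m}. T i (Suc j) \<le> T i j"
      using assms(1) unfolding TSPP_def by blast
    have "j \<le> m \<Longrightarrow> T i j \<le> T i i" using ij
    proof (induction j rule: dec_induct)
      case (step n)
      then have "T i (Suc n) \<le> T i n" using r i by auto
      then show ?case using step by simp
    qed simp
    then show ?thesis using 1 jm j_def by simp
  qed
  have "as = map (\<lambda>i. ?p i - i) [1..<Suc (durfee ?p)]"
    "bs = map (\<lambda>i. T i i - i) [1..<Suc (durfee ?p)]"
    using assms(2) cp unfolding frobenius_def by (auto simp del: upt_Suc)
  then show ?thesis using main
    by (auto simp: list_all2_conv_all_nth simp del: upt_Suc intro!: diff_le_mono)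
qed

lemma TSPP_frobenius_sum_le:
  assumes "T \<in> TSPP (N - 1)" "frobenius (tspp_diag T) = (as, bs)"
  shows "(\<Sum>b\<leftarrow>bs. b + 1) \<le> N choose 2"
proof -
  let ?d = "\<lambda>i. T i i" and ?p = "tspp_diag T"
  have d: "is_partition ?d" by (rule TSPP_diagonal_partition[OF assms(1)])
  have p: "is_partition ?p" by (rule partition_tspp_diag[OF assms(1)])
  have cp: "conjugate ?p = ?d" unfolding tspp_diag_def by (rule conjugate_conjugate[OF d])
  have bs: "bs = map (\<lambda>i. T i i - i) [1..<Suc (durfee ?p)]"
    using assms(2) cp unfolding frobenius_def by (auto simp del: upt_Suc)
  have Tm: "T i i \<le> N - 1" for i using assms(1) unfolding TSPP_def by blast
  have "b + 1 \<in> {0..<N}" if "b \<in> set bs" for b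
  proof -
    have "b \<in> (\<lambda>i. T i i - i) ` {1..<Suc (durfee ?p)}"
      using that bs by (simp only: set_map set_upt)
    then obtain i where i: "1 \<le> i" "i \<le> durfee ?p" "b = T i i - i" by auto
    have "i \<le> ?p i" using le_durfee_iff[OF p, of i] i by simp
    then have "i \<le> T i i" using le_conjugate_iff[OF d, of i i] i unfolding tspp_diag_def by simp
    then show ?thesis using Tm[of i] i by auto
  qed
  then have sub: "(\<lambda>b. b + 1) ` set bs \<subseteq> {0..<N}" by auto
  have "sorted_wrt (>) bs" using frobenius_strict[OF p assms(2)] by simp
  then have "distinct bs" by (induction bs) auto
  then have "(\<Sum>b\<leftarrow>bs. b + 1) = (\<Sum>b\<in>set bs. b + 1)" by (simp add: sum_list_distinct_conv_sum_set)
  also have "\<dots> = \<Sum>((\<lambda>b. b + 1) ` set bs)" by (simp add: sum.reindex)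
  also have "\<dots> \<le> \<Sum>{0..<N}" by (rule sum_mono2) (use sub in auto)
  also have "\<dots> = N choose 2" by (simp add: Sum_Ico_nat choose_two)
  finally show ?thesis .
qed

lemma partition_tspp_pi:
  assumes "T \<in> TSPP m" "frobenius (tspp_diag T) = (as, bs)"
  shows "is_partition (tspp_pi k T)" "frobenius (tspp_pi k T) = (as, map (\<lambda>b. b + k) bs)"
proof -
  note s = frobenius_strict[OF partition_tspp_diag[OF assms(1)] assms(2)]
  have "sorted_wrt (>) (map (\<lambda>b. b + k) bs)" using s(3) by (simp add: sorted_wrt_map)
  then show "is_partition (tspp_pi k T)" "frobenius (tspp_pi k T) = (as, map (\<lambda>b. b + k) bs)"
    using of_frobenius[of as "map (\<lambda>b. b + k) bs"] s assms(2) unfolding tspp_pi_def by auto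
qed

text \<open>All index sets of sums and products above are finite, so none of them collapses to its
  default value.\<close>

lemma finite_arrays:
  assumes "finite A"
  shows "finite {F :: nat \<Rightarrow> nat \<Rightarrow> nat. (\<forall>i j. F i j \<le> c) \<and> (\<forall>i j. (i, j) \<notin> A \<longrightarrow> F i j = 0)}"
    (is "finite ?S")
proof -
  let ?G = "{f. \<forall>x. (x \<in> A \<longrightarrow> f x \<in> {..c}) \<and> (x \<notin> A \<longrightarrow> f x = (0::nat))}"
  have "finite ?G" using assms by (intro finite_set_of_finite_funs) auto
  moreover have "?S \<subseteq> curry ` ?G"
  proof
    fix F assume "F \<in> ?S"
    then have "case_prod F \<in> ?G" by auto
    then show "F \<in> curry ` ?G" by (rule rev_image_eqI) simp
  qed
  ultimately show ?thesis by (rule finite_surj)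
qed

lemma finite_TSPP: "finite (TSPP m)"
  by (rule finite_subset[OF _ finite_arrays[of "{1..m} \<times> {1..m}" m]]) (auto simp: TSPP_def)

lemma finite_diagram:
  assumes "is_partition p"
  shows "finite (diagram p)"
proof -
  have "diagram p \<subseteq> (SIGMA i:{i. p i \<noteq> 0}. {..p i})" by (auto simp: diagram_def)
  moreover have "finite (SIGMA i:{i. p i \<noteq> 0}. {..p i})"
    using assms unfolding is_partition_def by auto
  ultimately show ?thesis by (rule finite_subset)
qed

lemma finite_SSYT:
  assumes "is_partition p"
  shows "finite (SSYT p n)"
proof (rule finite_subset[OF _ finite_arrays[OF finite_diagram[OF assms], of n]])
  show "SSYT p n \<subseteq> {F. (\<forall>i j. F i j \<le> n) \<and> (\<forall>i j. (i, j) \<notin> diagram p \<longrightarrow> F i j = 0)}"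
    unfolding SSYT_def by (auto, metis le0)
qed

lemma finite_shifted_diagram:
  assumes "is_partition p"
  shows "finite (shifted_diagram p)"
proof -
  have "shifted_diagram p \<subseteq> (SIGMA i:{i. p i \<noteq> 0}. {..i + p i})" by (auto simp: shifted_diagram_def)
  moreover have "finite (SIGMA i:{i. p i \<noteq> 0}. {..i + p i})"
    using assms unfolding is_partition_def by auto
  ultimately show ?thesis by (rule finite_subset)
qed

lemma finite_CSSPP: "finite (CSSPP n k)"
proof -
  let ?P = "{p. \<forall>i. (i \<in> {..n} \<longrightarrow> p i \<in> {..n}) \<and> (i \<notin> {..n} \<longrightarrow> p i = (0::nat))}"
  let ?A = "{..n} \<times> {..2 * n}"
  let ?F = "{F. (\<forall>i j. F i j \<le> n + k) \<and> (\<forall>i j. (i, j) \<notin> ?A \<longrightarrow> F i j = (0::nat))}"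
  have "CSSPP n k \<subseteq> ?P \<times> ?F"
  proof
    fix x assume "x \<in> CSSPP n k"
    then obtain p F where x: "x = (p, F)" and c: "is_csspp p F"
      and diag: "\<And>i. p i > 0 \<Longrightarrow> F i i = p i + k" and p1: "p 1 \<le> n"
      unfolding CSSPP_def by auto
    have p: "is_partition p" and st: "\<And>i. 1 \<le> i \<Longrightarrow> p i > 0 \<Longrightarrow> p (Suc i) < p i"
      using c unfolding is_csspp_def strict_partition_def by auto
    have out: "F i j = 0" if "(i, j) \<notin> shifted_diagram p" for i j
      using c that unfolding is_csspp_def by blast
    have row: "F i (Suc j) \<le> F i j"
      if "(i, j) \<in> shifted_diagram p" "(i, Suc j) \<in> shifted_diagram p" for i j
      using c that unfolding is_csspp_def by blast
    have p0: "p 0 = 0" using p unfolding is_partition_def by simp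
    have pn: "p i \<le> n" for i
      using partition_antimono[OF p, of 1 i] p1 p0 by (cases "i = 0") auto
    have bound: "p i > 0 \<Longrightarrow> p i + i \<le> Suc n" if "1 \<le> i" for i using that
    proof (induction i rule: dec_induct)
      case base
      then show ?case using p1 by simp
    next
      case (step i)
      then show ?case using st[of i] partition_antimono[OF p, of i "Suc i"] by force
    qed
    have len: "i \<le> n" if "p i > 0" for i
    proof -
      have "1 \<le> i" using that p0 by (cases "i = 0") auto
      then show ?thesis using bound[of i] that by linarith
    qed
    have "p \<in> ?P" using pn len by force
    moreover have "F i j = 0" if "(i, j) \<notin> ?A" for i j
    proof (rule out, rule notI)
      assume s: "(i, j) \<in> shifted_diagram p"
      then have "i \<le> n" "j < i + p i" using len unfolding shifted_diagram_def by auto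
      then show False using that pn[of i] by simp
    qed
    moreover have "F i j \<le> n + k" for i j
    proof (cases "(i, j) \<in> shifted_diagram p")
      case True
      then have i: "1 \<le> i" "i \<le> j" "j < i + p i" unfolding shifted_diagram_def by auto
      from i(2,3) have "F i j \<le> F i i"
      proof (induction j rule: dec_induct)
        case (step m)
        then have "F i (Suc m) \<le> F i m" using i by (intro row) (auto simp: shifted_diagram_def)
        then show ?case using step by simp
      qed simp
      then show ?thesis using diag[of i] pn[of i] i by simp
    qed (simp add: out)
    ultimately show "x \<in> ?P \<times> ?F" using x by simp
  qed
  moreover have "finite (?P \<times> ?F)"
    by (intro finite_cartesian_product finite_set_of_finite_funs finite_arrays) auto
  ultimately show ?thesis by (rule finite_subset)
qed

end

theory Submission
  imports "Jordan_Normal_Form.Determinant" Defs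
begin

text \<open>Both sides are sums of principal minors of an \<open>n \<times> n\<close> matrix \<open>M\<close>, weighted by \<open>r\<close> to the size of the
  minor; by the Cauchy--Binet formula such a sum is the same for \<open>AB\<close> and \<open>BA\<close>.

  All combinatorial objects involved decompose into column strict fillings of shifted diagrams
  with prescribed main diagonal: a CSSPP is such a filling, a TSPP corresponds to one
  by its cells with sorted coordinates, and a semistandard tableau is a pair of them glued along the
  diagonal. Removing the main diagonal and using multilinearity of the determinant shows that the
  weighted number of such fillings is a determinant of weighted numbers of single rows.

  With \<open>P\<^sub>k\<close> the matrix of the \<open>(i + k) choose (j + k)\<close>, \<open>P\<^sub>k\<^sup>t\<close> its formal power with
  entries \<open>((i + k) choose (j + k)) t\<^sup>i\<^sup>-\<^sup>j\<close>, and \<open>E\<close> the transpose of \<open>P\<^sub>0\<close>, this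
  yields \<open>M = P\<^sub>0\<^sup>t P\<^sub>k E P\<^sub>k\<close> for the TSPPs and \<open>M = P\<^sub>k\<^sup>t E\<close> for the CSSPPs. Moreover
  \<open>P\<^sub>i Z = P\<^sub>i\<^sub>+\<^sub>k\<close> for the Toeplitz matrix \<open>Z\<close> with entries \<open>k choose (i - j)\<close>, so
  \<open>P\<^sub>k P\<^sub>0\<^sup>t P\<^sub>k E\<close> is \<open>P\<^sub>0\<^sup>t\<^sup>+\<^sup>2 E\<close> for \<open>k = 0\<close>, \<open>P\<^sub>k\<^sup>2 E\<close> for \<open>t = 0\<close>, and
  \<open>P\<^sub>k P\<^sub>0\<^sup>-\<^sup>1 P\<^sub>0 Z E = P\<^sub>2\<^sub>k E\<close> for \<open>t = -1\<close>.\<close>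

section \<open>Determinants and minors\<close>

lemma det_mat_expand:
  "det (mat l l f) = (\<Sum>p | p permutes {0..<l}. signof p * (\<Prod>i = 0..<l. f (i, p i)))"
proof -
  have "(\<Prod>i = 0..<l. mat l l f $$ (i, p i)) = (\<Prod>i = 0..<l. f (i, p i))"
    if "p permutes {0..<l}" for p
    using permutes_in_image[OF that] by (intro prod.cong) auto
  then show ?thesis
    by (subst det_def'[of _ l]) (auto intro!: sum.cong)
qed

lemma det_mat_cong:
  "(\<And>i j. i < l \<Longrightarrow> j < l \<Longrightarrow> f (i, j) = g (i, j)) \<Longrightarrow> det (mat l l f) = det (mat l l g)"
  by (rule arg_cong[of _ _ det]) auto

lemma det_mat_transpose: "det (mat l l (\<lambda>(i, j). f j i)) = det (mat l l (\<lambda>(i, j). f i j))"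
proof -
  have "mat l l (\<lambda>(i, j). f j i) = transpose_mat (mat l l (\<lambda>(i, j). f i j))" by auto
  then show ?thesis by (simp add: det_transpose[of _ l])
qed

lemma det_mat_scale_rows:
  "det (mat l l (\<lambda>(i, j). c i * f i j)) = (\<Prod>i = 0..<l. c i) * det (mat l l (\<lambda>(i, j). f i j))"
  by (simp add: det_mat_expand prod.distrib sum_distrib_left mult_ac)

text \<open>Multilinearity in the rows: a choice function \<open>h\<close> picks one summand for
  each row.\<close>

lemma det_mat_sum_rows:
  assumes "\<And>i. i < l \<Longrightarrow> finite (I i)"
  shows "det (mat l l (\<lambda>(i, j). \<Sum>e\<in>I i. g i e j)) =
    (\<Sum>h\<in>Pi\<^sub>E {0..<l} I. det (mat l l (\<lambda>(i, j). g i (h i) j)))"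
proof -
  have "(\<Prod>i = 0..<l. \<Sum>e\<in>I i. g i e (p i)) =
    (\<Sum>h\<in>Pi\<^sub>E {0..<l} I. \<Prod>i = 0..<l. g i (h i) (p i))" for p
    by (rule prod_sum_PiE) (use assms in auto)
  then have "det (mat l l (\<lambda>(i, j). \<Sum>e\<in>I i. g i e j)) =
    (\<Sum>p | p permutes {0..<l}. \<Sum>h\<in>Pi\<^sub>E {0..<l} I. signof p * (\<Prod>i = 0..<l. g i (h i) (p i)))"
    by (simp add: det_mat_expand sum_distrib_left)
  then show ?thesis
    by (subst (asm) sum.swap) (simp add: det_mat_expand)
qed

text \<open>Subtracting from each row its successor is left multiplication by an upper unitriangular
  matrix. Read backwards, it later turns interval sums into sums over all values up to a
  bound.\<close>

lemma det_mat_row_differences: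
  fixes f :: "nat \<Rightarrow> nat \<Rightarrow> 'a::comm_ring_1"
  shows "det (mat l l (\<lambda>(i, j). f i j - (if Suc i < l then f (Suc i) j else 0))) =
    det (mat l l (\<lambda>(i, j). f i j))" (is "det ?D = det ?F")
proof -
  let ?U = "mat l l (\<lambda>(i, j). if j = i then 1 else if j = Suc i then - 1 else 0) :: 'a mat"
  have "?D = ?U * ?F"
  proof (rule eq_matI)
    fix i j assume "i < dim_row (?U * ?F)" "j < dim_col (?U * ?F)"
    then have ij: "i < l" "j < l" by simp_all
    have "(?U * ?F) $$ (i, j) =
      (\<Sum>k = 0..<l. (if k = i then f k j else 0) + (if k = Suc i then - f k j else 0))"
      using ij by (auto simp: scalar_prod_def intro!: sum.cong)
    also have "\<dots> = f i j - (if Suc i < l then f (Suc i) j else 0)"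
      using ij by (subst sum.distrib) (auto simp: sum.delta)
    finally show "?D $$ (i, j) = (?U * ?F) $$ (i, j)" using ij by simp
  qed auto
  moreover have "det ?U = 1"
    by (subst det_upper_triangular[of _ l])
      (auto simp: upper_triangular_def prod_list_diag_prod)
  ultimately show ?thesis by (simp add: det_mult[of _ l])
qed

text \<open>Laplace expansion along a column whose only possibly nonzero entry is in the corner; it
  later removes an empty last row of a shape.\<close>

lemma det_mat_last_column:
  assumes "\<And>i. i < l \<Longrightarrow> f (i, l) = 0"
  shows "det (mat (Suc l) (Suc l) f) = f (l, l) * det (mat l l f)"
proof -
  let ?A = "mat (Suc l) (Suc l) f"
  have "mat_delete ?A l l = mat l l f" by (rule eq_matI) (auto simp: mat_delete_def)
  then have "cofactor ?A l l = det (mat l l f)"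
    by (simp add: cofactor_def flip: mult_2)
  moreover have "det ?A = (\<Sum>i<Suc l. ?A $$ (i, l) * cofactor ?A i l)"
    by (rule laplace_expansion_column) auto
  ultimately show ?thesis using assms by (simp add: sum.neutral)
qed

section \<open>Minors indexed by decreasing lists, and the Cauchy-Binet formula\<close>

definition minor :: "(nat \<Rightarrow> nat \<Rightarrow> 'a::comm_ring_1) \<Rightarrow> nat list \<Rightarrow> nat list \<Rightarrow> 'a" where
  "minor A xs ys = det (mat (length xs) (length xs) (\<lambda>(i, j). A (xs ! i) (ys ! j)))"

text \<open>Subsets of \<open>{..<N}\<close> are stored as decreasing lists, the order in which
  Frobenius coordinates come, so the same lists index minors and describe partitions.\<close>

definition decr_lists :: "nat \<Rightarrow> nat list set" where
  "decr_lists N = {xs. sorted_wrt (>) xs \<and> set xs \<subseteq> {..<N}}"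

lemma sorted_wrt_greater_distinct: "sorted_wrt (>) xs \<Longrightarrow> distinct (xs :: nat list)"
  by (induction xs) auto

lemma finite_decr_lists: "finite (decr_lists N)"
proof (rule finite_subset)
  show "decr_lists N \<subseteq> {xs. distinct xs \<and> set xs \<subseteq> {..<N}}"
    using sorted_wrt_greater_distinct by (auto simp: decr_lists_def)
  show "finite {xs. distinct xs \<and> set xs \<subseteq> {..<N}}"
    using finite_subset_distinct[of "{..<N}"] by (simp add: conj_commute)
qed

lemma decr_lists_nth: "xs \<in> decr_lists N \<Longrightarrow> i < length xs \<Longrightarrow> xs ! i < N"
  using subsetD[of "set xs" "{..<N}" "xs ! i"] by (simp add: decr_lists_def)

lemma minor_cong:
  assumes "\<And>i j. i \<in> set xs \<Longrightarrow> j \<in> set ys \<Longrightarrow> A i j = B i j" "length xs = length ys"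
  shows "minor A xs ys = minor B xs ys"
  unfolding minor_def by (rule det_mat_cong) (simp add: assms)

lemma minor_transpose:
  "length xs = length ys \<Longrightarrow> minor (\<lambda>i j. A j i) xs ys = minor A ys xs"
  unfolding minor_def by (simp add: det_mat_transpose[of _ "\<lambda>i j. A (ys ! i) (xs ! j)"])

lemma sorted_wrt_greater_unique:
  assumes "sorted_wrt (>) xs" "sorted_wrt (>) ys" "set xs = set (ys :: nat list)"
  shows "xs = ys"
proof -
  have "sorted_wrt (<) (rev xs)" "sorted_wrt (<) (rev ys)" using assms by (simp_all add: sorted_wrt_rev)
  then have "rev xs = rev ys"
    using assms(3) by (intro sorted_distinct_set_unique) (auto simp: strict_sorted_iff)
  then show ?thesis by simp
qed

text \<open>Expanding by rows gives one term for each map \<open>h\<close> from row positions to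
  middle indices. A non-injective map repeats a row of \<open>B\<close>; an injective one is
  uniquely a decreasing list composed with a permutation. The sign from sorting the rows of
  \<open>B\<close> then turns the products of entries of \<open>A\<close> into the first
  minor.\<close>

lemma Cauchy_Binet:
  fixes A B :: "nat \<Rightarrow> nat \<Rightarrow> 'a::comm_ring_1"
  assumes xy: "length xs = length ys"
  shows "minor (\<lambda>i j. \<Sum>k<N. A i k * B k j) xs ys =
    (\<Sum>zs | zs \<in> decr_lists N \<and> length zs = length xs. minor A xs zs * minor B zs ys)"
proof -
  define l where "l = length xs"
  let ?Z = "{zs \<in> decr_lists N. length zs = l}"
  let ?P = "{p. p permutes {0..<l}}"
  let ?E = "Pi\<^sub>E {0..<l} (\<lambda>_. {..<N})"
  let ?D = "\<lambda>h. det (mat l l (\<lambda>(i, j). B (h i) (ys ! j)))"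
  let ?g = "\<lambda>h. (\<Prod>i = 0..<l. A (xs ! i) (h i)) * ?D h"
  \<comment> \<open>The decreasing list records the image of an injective map, the permutation the
    order in which the image is run through.\<close>
  let ?\<phi> = "\<lambda>(zs :: nat list, p). \<lambda>i\<in>{0..<l}. zs ! p i"
  have bij: "bij_betw ?\<phi> (?Z \<times> ?P) {h \<in> ?E. inj_on h {0..<l}}"
    unfolding bij_betw_def
  proof
    have img: "h ` {0..<l} = set zs" if "zs \<in> ?Z" "p \<in> ?P" "h = ?\<phi> (zs, p)" for zs p h
    proof -
      have "h ` {0..<l} = (!) zs ` p ` {0..<l}" using that(3) by (auto simp: image_iff)
      also have "\<dots> = (!) zs ` {0..<l}" using that(2) by (simp add: permutes_image)
      also have "\<dots> = set zs" using that(1) by (force simp: set_conv_nth)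
      finally show ?thesis .
    qed
    show "inj_on ?\<phi> (?Z \<times> ?P)"
    proof (rule inj_onI, clarify)
      fix zs p zs' p'
      assume a: "zs \<in> decr_lists N" "l = length zs" "zs' \<in> decr_lists N" "length zs' = length zs"
        "p permutes {0..<length zs}" "p' permutes {0..<length zs}"
        "(\<lambda>i\<in>{0..<length zs}. zs ! p i) = (\<lambda>i\<in>{0..<length zs}. zs' ! p' i)"
      have "set zs = set zs'"
        using img[of zs p "?\<phi> (zs, p)"] img[of zs' p' "?\<phi> (zs', p')"] a by simp
      then have z: "zs = zs'"
        using a sorted_wrt_greater_unique by (auto simp: decr_lists_def)
      have "distinct zs" using a sorted_wrt_greater_distinct by (auto simp: decr_lists_def)
      moreover have "zs ! p i = zs ! p' i" if "i < l" for i
        using fun_cong[OF a(7), of i] that a(2) z by simp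
      ultimately have "p i = p' i" if "i < l" for i
        using that a permutes_in_image[OF a(5), of i] permutes_in_image[OF a(6), of i]
        by (simp add: nth_eq_iff_index_eq)
      moreover have "p i = p' i" if "\<not> i < l" for i
        using that a by (simp add: permutes_def)
      ultimately show "zs = zs' \<and> p = p'" using z by blast
    qed
    show "?\<phi> ` (?Z \<times> ?P) = {h \<in> ?E. inj_on h {0..<l}}"
    proof (intro equalityI subsetI)
      fix h assume "h \<in> ?\<phi> ` (?Z \<times> ?P)"
      then obtain zs p where zp: "zs \<in> ?Z" "p \<in> ?P" "h = ?\<phi> (zs, p)" by auto
      have "set zs \<subseteq> {..<N}" using zp by (auto simp: decr_lists_def)
      then have "h \<in> ?E" using img[OF zp] zp(3) by (auto simp: PiE_def extensional_def)
      moreover have "card (h ` {0..<l}) = l"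
        using img[OF zp] zp(1) sorted_wrt_greater_distinct
        by (auto simp: decr_lists_def distinct_card)
      ultimately show "h \<in> {h \<in> ?E. inj_on h {0..<l}}" by (simp add: eq_card_imp_inj_on)
    next
      fix h assume h: "h \<in> {h \<in> ?E. inj_on h {0..<l}}"
      define hs where "hs = map h [0..<l]"
      define zs where "zs = rev (sort hs)"
      have d: "distinct hs" using h by (simp add: hs_def distinct_map)
      have "sorted_wrt (<) (sort hs)" using d by (simp add: strict_sorted_iff)
      then have "sorted_wrt (>) zs" unfolding zs_def by (simp add: sorted_wrt_rev)
      moreover have "set zs \<subseteq> {..<N}" using h by (auto simp: zs_def hs_def)
      ultimately have z: "zs \<in> ?Z" by (auto simp: decr_lists_def zs_def hs_def)
      have "mset hs = mset zs" by (simp add: zs_def)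
      then obtain p where p: "p permutes {..<length zs}" "permute_list p zs = hs"
        by (rule mset_eq_permutation)
      have lz: "length zs = l" using z by simp
      have "h i = zs ! p i" if "i < l" for i
        using permute_list_nth[OF p(1), of i] p(2) that lz by (simp add: hs_def)
      then have "h = ?\<phi> (zs, p)" using h by (auto simp: PiE_def extensional_def)
      moreover have "p \<in> ?P" using p(1) lz by (simp add: atLeast0LessThan)
      ultimately show "h \<in> ?\<phi> ` (?Z \<times> ?P)" using z by blast
    qed
  qed
  have "minor (\<lambda>i j. \<Sum>k<N. A i k * B k j) xs ys =
    (\<Sum>h\<in>?E. det (mat l l (\<lambda>(i, j). A (xs ! i) (h i) * B (h i) (ys ! j))))"
    unfolding minor_def l_def[symmetric]
    by (rule det_mat_sum_rows[of l "\<lambda>_. {..<N}" "\<lambda>i k j. A (xs ! i) k * B k (ys ! j)"]) simp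
  also have "\<dots> = (\<Sum>h\<in>?E. ?g h)"
    by (intro sum.cong refl det_mat_scale_rows)
  also have "\<dots> = (\<Sum>h\<in>{h \<in> ?E. inj_on h {0..<l}}. ?g h)"
  proof (rule sum.mono_neutral_right)
    show "\<forall>h\<in>?E - {h \<in> ?E. inj_on h {0..<l}}. ?g h = 0"
    proof
      fix h assume "h \<in> ?E - {h \<in> ?E. inj_on h {0..<l}}"
      then obtain i j where ij: "i < l" "j < l" "i \<noteq> j" "h i = h j" by (auto simp: inj_on_def)
      have "?D h = 0"
        by (rule det_identical_rows[of _ l i j]) (use ij in \<open>auto simp: row_def\<close>)
      then show "?g h = 0" by simp
    qed
  qed (auto intro: finite_PiE)
  also have "\<dots> = (\<Sum>x\<in>?Z \<times> ?P. ?g (?\<phi> x))"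
    by (rule sum.reindex_bij_betw[OF bij, symmetric])
  also have "\<dots> = (\<Sum>(zs, p)\<in>?Z \<times> ?P. ?g (\<lambda>i. zs ! p i))"
  proof (rule sum.cong[OF refl])
    fix x :: "nat list \<times> (nat \<Rightarrow> nat)"
    obtain zs p where x: "x = (zs, p)" by (cases x)
    have "?D (?\<phi> x) = ?D (\<lambda>i. zs ! p i)" unfolding x by (rule det_mat_cong) simp
    then show "?g (?\<phi> x) = (case x of (zs, p) \<Rightarrow> ?g (\<lambda>i. zs ! p i))" using x by simp
  qed
  also have "\<dots> = (\<Sum>zs\<in>?Z. \<Sum>p\<in>?P. ?g (\<lambda>i. zs ! p i))"
    by (rule sum.cartesian_product[symmetric])
  also have "\<dots> = (\<Sum>zs\<in>?Z. minor A xs zs * minor B zs ys)"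
  proof (rule sum.cong)
    fix zs assume z: "zs \<in> ?Z"
    have "?D (\<lambda>i. zs ! p i) = signof p * minor B zs ys" if "p \<in> ?P" for p
    proof -
      have "?D (\<lambda>i. zs ! p i) =
        det (mat l l (\<lambda>(i, j). mat l l (\<lambda>(i, j). B (zs ! i) (ys ! j)) $$ (p i, j)))"
        by (rule det_mat_cong) (use that permutes_in_image[of p "{0..<l}"] in auto)
      also have "\<dots> = signof p * minor B zs ys"
        using z that by (subst det_permute_rows) (auto simp: minor_def)
      finally show ?thesis .
    qed
    then have "(\<Sum>p\<in>?P. ?g (\<lambda>i. zs ! p i)) =
      (\<Sum>p\<in>?P. signof p * (\<Prod>i = 0..<l. A (xs ! i) (zs ! p i))) * minor B zs ys"
      by (simp add: sum_distrib_left mult_ac)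
    also have "\<dots> = minor A xs zs * minor B zs ys"
      by (simp add: minor_def det_mat_expand l_def)
    finally show "(\<Sum>p\<in>?P. ?g (\<lambda>i. zs ! p i)) = minor A xs zs * minor B zs ys" .
  qed simp
  finally show ?thesis by (simp add: l_def)
qed

text \<open>By the expansion of a determinant into principal minors, this is the determinant of
  \<open>1 + r A\<close> for the \<open>N\<close> by \<open>N\<close> truncation of
  \<open>A\<close>.\<close>

definition minor_gf :: "nat \<Rightarrow> 'a::comm_ring_1 \<Rightarrow> (nat \<Rightarrow> nat \<Rightarrow> 'a) \<Rightarrow> 'a" where
  "minor_gf N r A = (\<Sum>xs\<in>decr_lists N. r ^ length xs * minor A xs xs)"

lemma minor_gf_cong:
  assumes "\<And>i j. i < N \<Longrightarrow> j < N \<Longrightarrow> A i j = B i j"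
  shows "minor_gf N r A = minor_gf N r B"
proof -
  have "minor A xs xs = minor B xs xs" if "xs \<in> decr_lists N" for xs
    by (rule minor_cong) (use that assms in \<open>auto simp: decr_lists_def\<close>)
  then show ?thesis by (simp add: minor_gf_def)
qed

lemma minor_gf_transpose: "minor_gf N r (\<lambda>i j. A j i) = minor_gf N r A"
proof -
  have "minor (\<lambda>i j. A j i) xs xs = minor A xs xs" for xs
    by (rule minor_transpose) (rule refl)
  then show ?thesis unfolding minor_gf_def by (rule sum.cong[OF refl arg_cong])
qed

text \<open>The analogue of det(1 + AB) = det(1 + BA): Cauchy-Binet writes both sides as the same
  double sum over pairs of index lists of equal length.\<close>

lemma minor_gf_commute:
  "minor_gf N r (\<lambda>i j. \<Sum>k<N. A i k * B k j) = minor_gf N r (\<lambda>i j. \<Sum>k<N. B i k * A k j)"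
proof -
  \<comment> \<open>The length condition moves into the summand, so that the two sums range
    independently and can be swapped.\<close>
  have gf: "minor_gf N r (\<lambda>i j. \<Sum>k<N. A i k * B k j) = (\<Sum>xs\<in>decr_lists N. \<Sum>zs\<in>decr_lists N.
      if length zs = length xs then r ^ length xs * (minor A xs zs * minor B zs xs) else 0)"
    for A B :: "nat \<Rightarrow> nat \<Rightarrow> 'a"
    unfolding minor_gf_def
  proof (rule sum.cong[OF refl])
    fix xs
    show "r ^ length xs * minor (\<lambda>i j. \<Sum>k<N. A i k * B k j) xs xs = (\<Sum>zs\<in>decr_lists N.
      if length zs = length xs then r ^ length xs * (minor A xs zs * minor B zs xs) else 0)"
      by (simp only: Cauchy_Binet sum_distrib_left sum.inter_filter[OF finite_decr_lists, symmetric])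
  qed
  have "minor_gf N r (\<lambda>i j. \<Sum>k<N. A i k * B k j) = (\<Sum>zs\<in>decr_lists N. \<Sum>xs\<in>decr_lists N.
      if length zs = length xs then r ^ length xs * (minor A xs zs * minor B zs xs) else 0)"
    unfolding gf[of A B] by (rule sum.swap)
  also have "\<dots> = (\<Sum>zs\<in>decr_lists N. \<Sum>xs\<in>decr_lists N.
      if length xs = length zs then r ^ length zs * (minor B zs xs * minor A xs zs) else 0)"
    by (rule sum.cong[OF refl], rule sum.cong[OF refl]) (metis mult.commute)
  also have "\<dots> = minor_gf N r (\<lambda>i j. \<Sum>k<N. B i k * A k j)"
    by (rule gf[symmetric])
  finally show ?thesis .
qed

section \<open>Fillings of shifted diagrams\<close>

definition shifted_fillings :: "(nat \<Rightarrow> nat) \<Rightarrow> (nat \<Rightarrow> nat) \<Rightarrow> (nat \<Rightarrow> nat \<Rightarrow> nat) set" where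
  "shifted_fillings p d = {F. (\<forall>i. F i i = d i) \<and>
     (\<forall>i j. (i, j) \<notin> shifted_diagram p \<longrightarrow> F i j = 0) \<and>
     (\<forall>i j. (i, j) \<in> shifted_diagram p \<and> (i, Suc j) \<in> shifted_diagram p \<longrightarrow> F i (Suc j) \<le> F i j) \<and>
     (\<forall>i j. (i, j) \<in> shifted_diagram p \<and> (Suc i, j) \<in> shifted_diagram p \<longrightarrow> F (Suc i) j < F i j)}"

definition filling_weight ::
    "(nat \<Rightarrow> nat) \<Rightarrow> (nat \<Rightarrow> nat \<Rightarrow> 'a) \<Rightarrow> (nat \<Rightarrow> nat \<Rightarrow> nat) \<Rightarrow> 'a::comm_ring_1" where
  "filling_weight p w F = (\<Prod>(i, j)\<in>shifted_diagram p. w (j - i) (F i j))"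

text \<open>Total weight of the weakly decreasing rows of given length with first entry
  \<open>x\<close>, where \<open>c\<close> in \<open>w c\<close> counts cells from the left. An
  empty row is given the value \<open>0\<close>, so the sum over \<open>e\<close> is
  \<open>1\<close> when the row ends.\<close>

primrec row_gf :: "nat \<Rightarrow> (nat \<Rightarrow> nat \<Rightarrow> 'a) \<Rightarrow> nat \<Rightarrow> 'a::comm_ring_1" where
  "row_gf 0 w x = (if x = 0 then 1 else 0)"
| "row_gf (Suc q) w x = w 0 x * (\<Sum>e\<le>x. row_gf q (\<lambda>c. w (Suc c)) e)"

text \<open>The last part may be \<open>0\<close>, which makes the induction on the
  diagonals below uniform.\<close>

definition strict_upto :: "nat \<Rightarrow> (nat \<Rightarrow> nat) \<Rightarrow> bool" where
  "strict_upto l p \<longleftrightarrow> (\<forall>i. i = 0 \<or> l < i \<longrightarrow> p i = 0) \<and> (\<forall>i j. 1 \<le> i \<and> i < j \<and> j \<le> l \<longrightarrow> p j < p i)"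

lemma strict_upto_less: "strict_upto l p \<Longrightarrow> 1 \<le> i \<Longrightarrow> i < j \<Longrightarrow> j \<le> l \<Longrightarrow> p j < p i"
  by (simp add: strict_upto_def)

lemma strict_upto_zero: "strict_upto l p \<Longrightarrow> i = 0 \<or> l < i \<Longrightarrow> p i = 0"
  by (auto simp: strict_upto_def)

lemma strict_upto_pos: "strict_upto l p \<Longrightarrow> 0 < p l \<Longrightarrow> 1 \<le> i \<Longrightarrow> i \<le> l \<Longrightarrow> 0 < p i"
  using strict_upto_less[of l p i l] by (cases "i = l") auto

lemma strict_upto_pred:
  assumes p: "strict_upto l p" "0 < p l"
  shows "strict_upto l (\<lambda>i. p i - 1)"
  unfolding strict_upto_def
proof (intro conjI allI impI)
  fix i j assume ij: "1 \<le> i \<and> i < j \<and> j \<le> l"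
  then show "p j - 1 < p i - 1"
    using strict_upto_pos[OF p, of j] strict_upto_less[OF p(1), of i j] by linarith
qed (use strict_upto_zero[OF p(1)] in simp)

text \<open>The values allowed to the right of the \<open>i\<close>-th diagonal cell: at most
  \<open>d i\<close> by the row condition, above \<open>d (Suc i)\<close> by the column condition.
  The last row has nothing below it, so there the value may drop to \<open>0\<close>, which also
  covers an exhausted row.\<close>

definition interlacing :: "nat \<Rightarrow> (nat \<Rightarrow> nat) \<Rightarrow> nat \<Rightarrow> nat set" where
  "interlacing l d i = (if i < l then {d (Suc i)<..d i} else {..d i})"

definition interlacing_seqs :: "nat \<Rightarrow> (nat \<Rightarrow> nat) \<Rightarrow> (nat \<Rightarrow> nat) set" where
  "interlacing_seqs l d = {e. (\<forall>i\<in>{1..l}. e i \<in> interlacing l d i) \<and> (\<forall>i. i \<notin> {1..l} \<longrightarrow> e i = 0)}"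

lemma finite_interlacing_seqs: "finite (interlacing_seqs l d)"
proof -
  let ?b = "Max (d ` {1..l})"
  have "e i \<le> ?b" if "e \<in> interlacing_seqs l d" "i \<in> {1..l}" for e i
  proof -
    have "e i \<le> d i" using that by (auto simp: interlacing_seqs_def interlacing_def split: if_splits)
    also have "\<dots> \<le> ?b" using that by (intro Max_ge) auto
    finally show ?thesis .
  qed
  then have "interlacing_seqs l d \<subseteq> {e. \<forall>i. (i \<in> {1..l} \<longrightarrow> e i \<in> {..?b}) \<and> (i \<notin> {1..l} \<longrightarrow> e i = 0)}"
    by (auto simp: interlacing_seqs_def)
  then show ?thesis by (rule finite_subset) (intro finite_set_of_finite_funs, auto)
qed

lemma strict_upto_interlacing:
  assumes "strict_upto l d" "e \<in> interlacing_seqs l d"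
  shows "strict_upto l e"
  unfolding strict_upto_def
proof (intro conjI allI impI)
  fix i assume "i = 0 \<or> l < i"
  then show "e i = 0" using assms(2) by (auto simp: interlacing_seqs_def)
next
  fix i j assume ij: "1 \<le> i \<and> i < j \<and> j \<le> l"
  have "e i \<in> interlacing l d i" "e j \<in> interlacing l d j"
    using assms(2) ij by (auto simp: interlacing_seqs_def)
  then have "e j \<le> d j" "d (Suc i) < e i" using ij by (auto simp: interlacing_def split: if_splits)
  moreover have "d j \<le> d (Suc i)"
    using assms(1) ij by (cases "j = Suc i") (auto simp: strict_upto_def intro!: less_imp_le)
  ultimately show "e j < e i" by linarith
qed

lemma shifted_diagram_pred:
  assumes "strict_upto l p" "0 < p l"
  shows "shifted_diagram p = (\<lambda>i. (i, i)) ` {1..l} \<union> apsnd Suc ` shifted_diagram (\<lambda>i. p i - 1)"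
    (is "?A = ?B")
proof -
  have pos: "0 < p i" if "1 \<le> i" "i \<le> l" for i
    using strict_upto_pos[OF assms] that by simp
  have z: "p i = 0" if "l < i" for i using assms(1) that by (simp add: strict_upto_def)
  have "(i, j) \<in> ?B \<longleftrightarrow> i = j \<and> 1 \<le> i \<and> i \<le> l \<or> (1 \<le> i \<and> i < j \<and> j < i + p i)" for i j
    by (cases j) (auto simp: shifted_diagram_def image_iff)
  moreover have "(i, j) \<in> ?A \<longleftrightarrow> i = j \<and> 1 \<le> i \<and> i \<le> l \<or> (1 \<le> i \<and> i < j \<and> j < i + p i)" for i j
  proof -
    have "0 < p i \<longleftrightarrow> i \<le> l" if "1 \<le> i" using pos[of i] z[of i] that by (cases "i \<le> l") auto
    then show ?thesis by (auto simp: shifted_diagram_def)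
  qed
  ultimately show ?thesis by (intro subset_antisym subrelI) (simp_all only:)
qed

text \<open>Deleting the main diagonal and moving the rest one column to the left shortens each of
  the \<open>l\<close> nonempty rows by one, and the new diagonal interlaces the old one. If the
  last row becomes empty, then \<open>e l\<close> is forced to be \<open>0\<close>.\<close>

lemma bij_betw_peel_diagonal:
  assumes p: "strict_upto l p" "0 < p l" and d: "strict_upto l d"
    and q: "\<And>i. q i = p i - 1"
  shows "bij_betw (\<lambda>(e, F) i j. if i = j then d i else if i < j then F i (j - 1) else 0)
    (SIGMA e:interlacing_seqs l d. shifted_fillings q e) (shifted_fillings p d)"
    (is "bij_betw ?\<phi> ?S ?F")
proof (rule bij_betw_byWitness)
  let ?\<psi> = "\<lambda>F. (\<lambda>i. F i (Suc i), \<lambda>i j. if i \<le> j then F i (Suc j) else 0)"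
  have pos: "0 < p i" if "1 \<le> i" "i \<le> l" for i
    using strict_upto_pos[OF p] that by simp
  have z: "p i = 0" "d i = 0" if "i = 0 \<or> l < i" for i
    using p d that by (auto simp: strict_upto_def)
  have sd: "(i, j) \<in> shifted_diagram q \<longleftrightarrow> 1 \<le> i \<and> i \<le> l \<and> i \<le> j \<and> Suc j < i + p i" for i j
    using z(1)[of i] by (cases "i \<le> l") (auto simp: shifted_diagram_def q)
  have sd': "(i, j) \<in> shifted_diagram p \<longleftrightarrow> 1 \<le> i \<and> i \<le> l \<and> i \<le> j \<and> j < i + p i" for i j
    using z(1)[of i] by (cases "i \<le> l") (auto simp: shifted_diagram_def q)
  show "\<forall>a\<in>?S. ?\<psi> (?\<phi> a) = a"
  proof
    fix a assume "a \<in> ?S"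
    then obtain e F where a: "a = (e, F)" "F \<in> shifted_fillings q e" by auto
    have "F i i = e i" "j < i \<Longrightarrow> F i j = 0" for i j
      using a(2) by (auto simp: shifted_fillings_def sd)
    then show "?\<psi> (?\<phi> a) = a" unfolding a(1) by (auto simp: fun_eq_iff)
  qed
  show "\<forall>F\<in>?F. ?\<phi> (?\<psi> F) = F"
  proof
    fix F assume "F \<in> ?F"
    then have "F i i = d i" "j < i \<Longrightarrow> F i j = 0" for i j
      by (auto simp: shifted_fillings_def sd')
    then show "?\<phi> (?\<psi> F) = F" by (fastforce simp: fun_eq_iff not_less)
  qed
  show "?\<psi> ` ?F \<subseteq> ?S"
  proof
    fix x assume "x \<in> ?\<psi> ` ?F"
    then obtain F where x: "x = ?\<psi> F" and F: "F \<in> ?F" by auto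
    have out: "F i j = 0" if "(i, j) \<notin> shifted_diagram p" for i j
      using F that by (auto simp: shifted_fillings_def)
    have diag: "F i i = d i" for i using F by (auto simp: shifted_fillings_def)
    have row: "F i (Suc j) \<le> F i j" if "i \<le> j" for i j
      using F that out[of i "Suc j"] by (cases "(i, Suc j) \<in> shifted_diagram p")
        (auto simp: shifted_fillings_def sd')
    have col: "F (Suc i) j < F i j" if "(i, j) \<in> shifted_diagram p" "(Suc i, j) \<in> shifted_diagram p" for i j
      using F that by (auto simp: shifted_fillings_def)
    have "F i (Suc i) \<in> interlacing l d i" if i: "1 \<le> i" "i \<le> l" for i
    proof (cases "i < l")
      case True
      \<comment> \<open>Strictness of the shape puts both \<open>(i, Suc i)\<close> and the diagonal
        cell below it into the diagram.\<close>
      have "p (Suc i) < p i" "0 < p (Suc i)" using True i p(1) pos by (auto simp: strict_upto_def)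
      then have "F (Suc i) (Suc i) < F i (Suc i)" using True i by (intro col) (auto simp: sd')
      then show ?thesis using True row[of i i] diag by (simp add: interlacing_def)
    qed (use row[of i i] diag in \<open>simp add: interlacing_def\<close>)
    then have "(\<lambda>i. F i (Suc i)) \<in> interlacing_seqs l d"
      by (auto simp: interlacing_seqs_def sd' intro!: out)
    moreover have "(\<lambda>i j. if i \<le> j then F i (Suc j) else 0) \<in> shifted_fillings q (\<lambda>i. F i (Suc i))"
      unfolding shifted_fillings_def by (auto simp: sd sd' intro!: row col out)
    ultimately show "x \<in> ?S" using x by simp
  qed
  show "?\<phi> ` ?S \<subseteq> ?F"
  proof
    fix x assume "x \<in> ?\<phi> ` ?S"
    then obtain e F where e: "e \<in> interlacing_seqs l d" and F: "F \<in> shifted_fillings q e"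
      and x: "x = ?\<phi> (e, F)" by auto
    have out: "F i j = 0" if "(i, j) \<notin> shifted_diagram q" for i j
      using F that by (auto simp: shifted_fillings_def)
    have diag: "F i i = e i" for i using F by (auto simp: shifted_fillings_def)
    have row: "F i (Suc j) \<le> F i j" if "(i, j) \<in> shifted_diagram q" "(i, Suc j) \<in> shifted_diagram q" for i j
      using F that by (auto simp: shifted_fillings_def)
    have col: "F (Suc i) j < F i j" if "(i, j) \<in> shifted_diagram q" "(Suc i, j) \<in> shifted_diagram q" for i j
      using F that by (auto simp: shifted_fillings_def)
    have ei: "e i \<le> d i" "i < l \<Longrightarrow> d (Suc i) < e i" if "1 \<le> i" "i \<le> l" for i
      using e that by (auto simp: interlacing_seqs_def interlacing_def split: if_splits)
    have "x i (Suc j) \<le> x i j"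
      if s: "(i, j) \<in> shifted_diagram p" "(i, Suc j) \<in> shifted_diagram p" for i j
    proof (cases "i = j")
      case True
      then show ?thesis using s ei(1)[of i] diag by (simp add: x sd')
    next
      case False
      then show ?thesis using s row[of i "j - 1"] by (cases j) (auto simp: x sd sd')
    qed
    moreover have "x (Suc i) j < x i j"
      if s: "(i, j) \<in> shifted_diagram p" "(Suc i, j) \<in> shifted_diagram p" for i j
    proof (cases "j = Suc i")
      case True
      then show ?thesis using s ei(2)[of i] diag by (simp add: x sd')
    next
      case False
      then show ?thesis using s col[of i "j - 1"] by (cases j) (auto simp: x sd sd')
    qed
    moreover have "x i j = 0" if "(i, j) \<notin> shifted_diagram p" for i j
      using that out[of i "j - 1"] z(2)[of i] pos[of i]
      by (cases j; cases "i \<le> l") (auto simp: x sd sd' not_le not_less)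
    ultimately show "x \<in> ?F" by (auto simp: shifted_fillings_def x)
  qed
qed

lemma finite_shifted_diagram_strict: "strict_upto l p \<Longrightarrow> finite (shifted_diagram p)"
proof (rule finite_subset)
  assume "strict_upto l p"
  then have "p i = 0" if "l < i" for i using that by (simp add: strict_upto_def)
  then show "shifted_diagram p \<subseteq> (SIGMA i:{..l}. {..<i + p i})"
    by (fastforce simp: shifted_diagram_def not_le[symmetric])
qed auto

lemma filling_weight_peel:
  assumes p: "strict_upto l p" "0 < p l"
  shows "filling_weight p w (\<lambda>i j. if i = j then d i else if i < j then F i (j - 1) else 0) =
    (\<Prod>i = 1..l. w 0 (d i)) * filling_weight (\<lambda>i. p i - 1) (\<lambda>c. w (Suc c)) F" (is "filling_weight p w ?F = _")
proof -
  let ?p = "\<lambda>i. p i - 1"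
  have fin: "finite (shifted_diagram ?p)"
    by (rule finite_shifted_diagram_strict[OF strict_upto_pred[OF p]])
  have "filling_weight p w ?F =
    (\<Prod>(i, j)\<in>(\<lambda>i. (i, i)) ` {1..l}. w (j - i) (?F i j)) *
    (\<Prod>(i, j)\<in>apsnd Suc ` shifted_diagram ?p. w (j - i) (?F i j))"
    unfolding filling_weight_def shifted_diagram_pred[OF p]
    by (rule prod.union_disjoint) (use fin in \<open>auto simp: shifted_diagram_def\<close>)
  also have "(\<Prod>(i, j)\<in>(\<lambda>i. (i, i)) ` {1..l}. w (j - i) (?F i j)) = (\<Prod>i = 1..l. w 0 (d i))"
    by (subst prod.reindex) (auto simp: inj_on_def)
  also have "(\<Prod>(i, j)\<in>apsnd Suc ` shifted_diagram ?p. w (j - i) (?F i j)) =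
    filling_weight ?p (\<lambda>c. w (Suc c)) F"
    unfolding filling_weight_def
    by (subst prod.reindex) (auto simp: inj_on_def shifted_diagram_def Suc_diff_le intro!: prod.cong)
  finally show ?thesis .
qed

lemma det_interlacing_sum:
  "det (mat l l (\<lambda>(i, j). \<Sum>e\<in>interlacing l d (Suc i). g e j)) =
    (\<Sum>e\<in>interlacing_seqs l d. det (mat l l (\<lambda>(i, j). g (e (Suc i)) j)))"
proof -
  let ?I = "\<lambda>i. interlacing l d (Suc i)"
  let ?\<phi> = "\<lambda>e. \<lambda>i\<in>{0..<l}. e (Suc i)" and ?\<psi> = "\<lambda>h i. if i \<in> {1..l} then h (i - 1) else (0::nat)"
  have bij: "bij_betw ?\<phi> (interlacing_seqs l d) (Pi\<^sub>E {0..<l} ?I)"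
  proof (rule bij_betw_byWitness[where f' = ?\<psi>])
    show "\<forall>e\<in>interlacing_seqs l d. ?\<psi> (?\<phi> e) = e"
      by (auto simp: interlacing_seqs_def fun_eq_iff)
    show "\<forall>h\<in>Pi\<^sub>E {0..<l} ?I. ?\<phi> (?\<psi> h) = h"
      by (auto simp: fun_eq_iff PiE_def extensional_def)
    show "?\<phi> ` interlacing_seqs l d \<subseteq> Pi\<^sub>E {0..<l} ?I"
      by (auto simp: interlacing_seqs_def)
    show "?\<psi> ` Pi\<^sub>E {0..<l} ?I \<subseteq> interlacing_seqs l d"
    proof clarify
      fix h assume h: "h \<in> Pi\<^sub>E {0..<l} ?I"
      have "h (i - 1) \<in> interlacing l d i" if "i \<in> {1..l}" for i
        using PiE_mem[OF h, of "i - 1"] that by auto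
      then show "?\<psi> h \<in> interlacing_seqs l d" by (auto simp: interlacing_seqs_def)
    qed
  qed
  have "det (mat l l (\<lambda>(i, j). \<Sum>e\<in>?I i. g e j)) =
    (\<Sum>h\<in>Pi\<^sub>E {0..<l} ?I. det (mat l l (\<lambda>(i, j). g (h i) j)))"
    by (rule det_mat_sum_rows) (simp add: interlacing_def)
  also have "\<dots> = (\<Sum>e\<in>interlacing_seqs l d. det (mat l l (\<lambda>(i, j). g (?\<phi> e i) j)))"
    by (rule sum.reindex_bij_betw[OF bij, symmetric])
  also have "\<dots> = (\<Sum>e\<in>interlacing_seqs l d. det (mat l l (\<lambda>(i, j). g (e (Suc i)) j)))"
    by (intro sum.cong refl det_mat_cong) simp
  finally show ?thesis .
qed

text \<open>An empty last row is expanded away; otherwise the main diagonal is peeled off. By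
  multilinearity the sum over interlacing diagonals is a determinant of interval sums, and row
  operations extend the intervals to all \<open>e \<le> d (Suc i)\<close>, which is the recursion of
  \<open>row_gf\<close>.\<close>

lemma sum_shifted_fillings:
  fixes w :: "nat \<Rightarrow> nat \<Rightarrow> 'a::comm_ring_1"
  assumes "strict_upto l p" "strict_upto l d" "\<And>c. w c 0 = 0"
  shows "finite (shifted_fillings p d)"
    and "(\<Sum>F\<in>shifted_fillings p d. filling_weight p w F) =
      det (mat l l (\<lambda>(i, j). row_gf (p (Suc j)) w (d (Suc i))))"
proof -
  have "finite (shifted_fillings p d) \<and> (\<Sum>F\<in>shifted_fillings p d. filling_weight p w F) =
      det (mat l l (\<lambda>(i, j). row_gf (p (Suc j)) w (d (Suc i))))"
    using assms
  proof (induction "l + p 1" arbitrary: l p d w rule: less_induct)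
    case less
    note p = less.prems(1) and d = less.prems(2) and w = less.prems(3)
    show ?case
    proof (cases "l = 0")
      case True
      have z: "p i = 0" "d i = 0" for i
        using True strict_upto_zero[OF p, of i] strict_upto_zero[OF d, of i] by auto
      have s: "shifted_diagram p = {}" by (auto simp: shifted_diagram_def z)
      have "shifted_fillings p d = {\<lambda>_ _. 0}"
        by (auto simp: shifted_fillings_def s z fun_eq_iff)
      then show ?thesis using True s by (simp add: filling_weight_def)
    next
      case False
      then obtain m where m: "l = Suc m" by (cases l) auto
      show ?thesis
      proof (cases "p l = 0")
        case pl: True
        \<comment> \<open>Only the last diagonal value can be \<open>0\<close>. In the column of the
          empty row, where \<open>row_gf 0\<close> tests for \<open>0\<close>, all entries above the
          last one therefore vanish.\<close>
        have dm: "0 < d (Suc i)" if "i < m" for i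
          using strict_upto_less[OF d, of "Suc i" l] that m by simp
        have det: "det (mat l l (\<lambda>(i, j). row_gf (p (Suc j)) w (d (Suc i)))) =
          row_gf 0 w (d l) * det (mat m m (\<lambda>(i, j). row_gf (p (Suc j)) w (d (Suc i))))"
          unfolding m using pl m dm by (subst det_mat_last_column) auto
        show ?thesis
        proof (cases "d l = 0")
          case dl: True
          have strict: "strict_upto m x" if "strict_upto l x" "x l = 0" for x
            using that unfolding strict_upto_def m by (auto simp: Suc_lessI le_Suc_eq)
              (metis Suc_lessI)
          have "finite (shifted_fillings p d) \<and> (\<Sum>F\<in>shifted_fillings p d. filling_weight p w F) =
              det (mat m m (\<lambda>(i, j). row_gf (p (Suc j)) w (d (Suc i))))"
            by (rule less.hyps) (use m w strict[OF p pl] strict[OF d dl] in auto)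
          then show ?thesis using det dl by simp
        next
          case dl: False
          \<comment> \<open>A nonzero diagonal value has no cell to sit in; the determinant agrees,
            as \<open>row_gf 0 w (d l)\<close> is \<open>0\<close>.\<close>
          have "(l, l) \<notin> shifted_diagram p" using pl by (simp add: shifted_diagram_def)
          then have "shifted_fillings p d = {}" using dl by (fastforce simp: shifted_fillings_def)
          then show ?thesis using det dl by simp
        qed
      next
        case pl: False
        then have pl': "0 < p l" by simp
        let ?p = "\<lambda>i. p i - 1" and ?w = "\<lambda>c. w (Suc c)"
        let ?E = "interlacing_seqs l d"
        let ?R = "\<lambda>j x. row_gf (p (Suc j) - 1) ?w x"
        let ?\<phi> = "\<lambda>(e :: nat \<Rightarrow> nat, F) i j. if i = j then d i else if i < j then F i (j - 1 :: nat) else 0"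
        have pp: "strict_upto l ?p" by (rule strict_upto_pred[OF p pl'])
        have "0 < p 1" using strict_upto_pos[OF p pl', of 1] m by simp
        then have small: "l + ?p 1 < l + p 1" by simp
        have IH: "finite (shifted_fillings ?p e)"
          "(\<Sum>F\<in>shifted_fillings ?p e. filling_weight ?p ?w F) = det (mat l l (\<lambda>(i, j). ?R j (e (Suc i))))"
          if "e \<in> ?E" for e
          using less.hyps[OF small pp strict_upto_interlacing[OF d that], of ?w] w by simp_all
        note bij = bij_betw_peel_diagonal[OF p pl' d, of ?p, OF refl]
        have "finite (SIGMA e:?E. shifted_fillings ?p e)"
          using IH finite_interlacing_seqs by blast
        then have fin: "finite (shifted_fillings p d)" using bij_betw_finite[OF bij] by blast
        have "(\<Sum>F\<in>shifted_fillings p d. filling_weight p w F) =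
          (\<Sum>x\<in>(SIGMA e:?E. shifted_fillings ?p e). filling_weight p w (?\<phi> x))"
          by (rule sum.reindex_bij_betw[OF bij, symmetric])
        also have "\<dots> = (\<Sum>(e, F)\<in>(SIGMA e:?E. shifted_fillings ?p e).
            (\<Prod>i = 1..l. w 0 (d i)) * filling_weight ?p ?w F)"
          by (rule sum.cong[OF refl]) (auto simp: filling_weight_peel[OF p pl'])
        also have "\<dots> = (\<Sum>e\<in>?E. \<Sum>F\<in>shifted_fillings ?p e. (\<Prod>i = 1..l. w 0 (d i)) * filling_weight ?p ?w F)"
          by (rule sum.Sigma[symmetric]) (use IH finite_interlacing_seqs in auto)
        also have "\<dots> = (\<Prod>i = 1..l. w 0 (d i)) *
            (\<Sum>e\<in>?E. det (mat l l (\<lambda>(i, j). ?R j (e (Suc i)))))"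
          by (simp only: IH(2) sum_distrib_left[symmetric] cong: sum.cong)
        also have "(\<Sum>e\<in>?E. det (mat l l (\<lambda>(i, j). ?R j (e (Suc i))))) =
            det (mat l l (\<lambda>(i, j). \<Sum>e\<in>interlacing l d (Suc i). ?R j e))"
          by (rule det_interlacing_sum[symmetric])
        \<comment> \<open>An interval sum is a difference of two initial sums, the second of which
          belongs to the next row.\<close>
        also have "\<dots> = det (mat l l (\<lambda>(i, j). (\<Sum>e\<le>d (Suc i). ?R j e) -
            (if Suc i < l then \<Sum>e\<le>d (Suc (Suc i)). ?R j e else 0)))"
        proof (rule det_mat_cong)
          fix i j assume "i < l"
          show "(case (i, j) of (i, j) \<Rightarrow> \<Sum>e\<in>interlacing l d (Suc i). ?R j e) =
            (case (i, j) of (i, j) \<Rightarrow> (\<Sum>e\<le>d (Suc i). ?R j e) -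
              (if Suc i < l then \<Sum>e\<le>d (Suc (Suc i)). ?R j e else 0))"
          proof (cases "Suc i < l")
            case True
            have le: "d (Suc (Suc i)) \<le> d (Suc i)"
              using strict_upto_less[OF d, of "Suc i" "Suc (Suc i)"] True by simp
            have "{d (Suc (Suc i))<..d (Suc i)} = {..d (Suc i)} - {..d (Suc (Suc i))}" by auto
            then show ?thesis using True le by (simp add: interlacing_def sum_diff)
          qed (simp add: interlacing_def)
        qed
        also have "\<dots> = det (mat l l (\<lambda>(i, j). \<Sum>e\<le>d (Suc i). ?R j e))"
          by (rule det_mat_row_differences)
        also have "(\<Prod>i = 1..l. w 0 (d i)) = (\<Prod>i = 0..<l. w 0 (d (Suc i)))"
          by (rule prod.reindex_bij_witness[of _ Suc "\<lambda>i. i - 1"]) auto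
        also have "\<dots> * det (mat l l (\<lambda>(i, j). \<Sum>e\<le>d (Suc i). ?R j e)) =
            det (mat l l (\<lambda>(i, j). w 0 (d (Suc i)) * (\<Sum>e\<le>d (Suc i). ?R j e)))"
          by (rule det_mat_scale_rows[symmetric])
        also have "\<dots> = det (mat l l (\<lambda>(i, j). row_gf (p (Suc j)) w (d (Suc i))))"
        proof (rule det_mat_cong)
          fix i j assume "j < l"
          then have "0 < p (Suc j)" using strict_upto_pos[OF p pl', of "Suc j"] by simp
          then obtain q where "p (Suc j) = Suc q" by (cases "p (Suc j)") auto
          then show "(case (i, j) of (i, j) \<Rightarrow> w 0 (d (Suc i)) * (\<Sum>e\<le>d (Suc i). ?R j e)) =
            (case (i, j) of (i, j) \<Rightarrow> row_gf (p (Suc j)) w (d (Suc i)))" by simp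
        qed
        finally show ?thesis using fin by blast
      qed
    qed
  qed
  then show "finite (shifted_fillings p d)"
    and "(\<Sum>F\<in>shifted_fillings p d. filling_weight p w F) =
      det (mat l l (\<lambda>(i, j). row_gf (p (Suc j)) w (d (Suc i))))" by auto
qed

section \<open>Closed forms for single rows\<close>

lemma row_gf_positive:
  "row_gf (Suc q) (\<lambda>c e. if 0 < e then 1 else 0) (Suc x) = (of_nat ((x + q) choose q) :: 'a::comm_ring_1)"
proof (induction q arbitrary: x)
  case (Suc q)
  let ?r = "row_gf (Suc q) (\<lambda>c e. if 0 < e then 1 else 0 :: 'a)"
  have "row_gf (Suc (Suc q)) (\<lambda>c e. if 0 < e then 1 else 0 :: 'a) (Suc x) = (\<Sum>e\<le>Suc x. ?r e)"
    by simp
  also have "\<dots> = (\<Sum>y\<le>x. of_nat ((q + y) choose q))"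
    by (simp only: sum.atMost_Suc_shift Suc.IH) (simp add: add.commute)
  also have "\<dots> = of_nat ((x + Suc q) choose Suc q)"
    using choose_rising_sum(1)[of q x] by (simp add: add_ac flip: of_nat_sum)
  finally show ?case .
qed simp

text \<open>Subtracting the column index from the entries makes the row strictly decreasing and
  keeps it above \<open>s\<close>, so the row amounts to a \<open>q\<close>-subset of the
  \<open>x - Suc s\<close> numbers strictly between \<open>s\<close> and \<open>x\<close>.\<close>

lemma row_gf_above_offset:
  "row_gf (Suc q) (\<lambda>c e. if c + s < e then 1 else 0) x =
    (if s < x then of_nat ((x - Suc s) choose q) else 0 :: 'a::comm_ring_1)"
proof (induction q arbitrary: s x)
  case (Suc q)
  have "(\<Sum>e\<le>x. if Suc s < e then of_nat ((e - Suc (Suc s)) choose q) else 0) =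
    (of_nat ((x - Suc s) choose Suc q) :: 'a)"
  proof (induction x)
    case (Suc x)
    have "Suc x - Suc s = Suc (x - Suc s)" if "s < x" using that by simp
    then show ?case using Suc.IH by (cases "s < x") (auto simp: add.commute)
  qed simp
  then show ?case using Suc.IH[of "Suc s"] by simp
qed simp

text \<open>The factor \<open>t\<close> marks the cells counted by \<open>csspp_mu\<close>; entries
  \<open>0\<close> are ruled out by weight \<open>0\<close>.\<close>

definition csspp_cell :: "nat \<Rightarrow> 'a \<Rightarrow> nat \<Rightarrow> nat \<Rightarrow> 'a::comm_ring_1" where
  "csspp_cell k t c e = (if e = 0 then 0 else if e \<le> k + c then t else 1)"

lemma csspp_cell_Suc: "(\<lambda>c. csspp_cell k t (Suc c)) = csspp_cell (Suc k) t"
  by (simp add: csspp_cell_def fun_eq_iff)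

lemma row_gf_csspp_cell_0: "row_gf (Suc q) (csspp_cell k t) 0 = 0"
  by (simp add: csspp_cell_def)

text \<open>A row starting at or below \<open>k\<close> stays below the rising threshold, so every
  cell is marked.\<close>

lemma row_gf_csspp_cell_le:
  "Suc y \<le> k \<Longrightarrow> row_gf (Suc q) (csspp_cell k t) (Suc y) = t ^ Suc q * of_nat ((y + q) choose q)"
proof (induction q arbitrary: k y)
  case (Suc q)
  have "row_gf (Suc (Suc q)) (csspp_cell k t) (Suc y) =
    t * (\<Sum>e\<le>Suc y. row_gf (Suc q) (csspp_cell (Suc k) t) e)"
    unfolding row_gf.simps(2)[of "Suc q"] csspp_cell_Suc using Suc.prems
    by (simp add: csspp_cell_def del: row_gf.simps)
  also have "\<dots> = t * (\<Sum>z\<le>y. t ^ Suc q * of_nat ((z + q) choose q))"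
    using Suc.prems by (simp only: sum.atMost_Suc_shift row_gf_csspp_cell_0) (simp add: Suc.IH del: row_gf.simps)
  also have "\<dots> = t ^ Suc (Suc q) * of_nat (\<Sum>z\<le>y. (q + z) choose q)"
    by (simp add: sum_distrib_left add.commute mult_ac)
  also have "(\<Sum>z\<le>y. (q + z) choose q) = (y + Suc q) choose Suc q"
    using choose_rising_sum(1)[of q y] by (simp add: add_ac)
  finally show ?case .
qed (simp add: csspp_cell_def)

text \<open>Marked cells form a final segment, because entries fall while the threshold rises. Here
  \<open>d\<close> is the number of unmarked cells after the first: their values can be chosen in
  \<open>y choose d\<close> ways, and those of the marked cells, bounded only by the threshold of
  the first of them, in \<open>(k + q) choose (k + d)\<close> ways.\<close>

lemma row_gf_csspp_cell_gt:
  "row_gf (Suc q) (csspp_cell k t) (Suc (k + y)) =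
    (\<Sum>d\<le>q. of_nat (y choose d) * of_nat ((k + q) choose (k + d)) * t ^ (q - d))"
proof (induction q arbitrary: k y)
  case 0
  then show ?case by (simp add: csspp_cell_def)
next
  case (Suc q)
  note IH = Suc.IH
  let ?r = "row_gf (Suc q) (csspp_cell (Suc k) t)"
  \<comment> \<open>\<open>?g\<close> collects the rows with an unmarked cell beyond the first; the
    separate summand below belongs to the rows whose later cells are all marked.\<close>
  let ?g = "\<lambda>y. \<Sum>d\<le>q. of_nat (y choose Suc d) * of_nat ((Suc k + q) choose (Suc k + d)) * t ^ (q - d)"
  have "(\<Sum>e\<le>Suc (k + y). ?r e) = t ^ Suc q * of_nat ((Suc k + q) choose Suc q) + ?g y"
  proof (induction y)
    case 0
    have "(\<Sum>e\<le>Suc (k + 0). ?r e) = (\<Sum>z\<le>k. t ^ Suc q * of_nat ((q + z) choose q))"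
      by (simp only: sum.atMost_Suc_shift row_gf_csspp_cell_0)
        (simp add: row_gf_csspp_cell_le add.commute del: row_gf.simps)
    also have "\<dots> = t ^ Suc q * of_nat (\<Sum>z\<le>k. (q + z) choose q)"
      by (simp add: sum_distrib_left)
    also have "(\<Sum>z\<le>k. (q + z) choose q) = (Suc k + q) choose Suc q"
      using choose_rising_sum(1)[of q k] by (simp add: add_ac)
    finally show ?case by simp
  next
    case (Suc y)
    have "(\<Sum>e\<le>Suc (k + Suc y). ?r e) = (\<Sum>e\<le>Suc (k + y). ?r e) + ?r (Suc (Suc k + y))"
      by (simp del: row_gf.simps)
    also have "\<dots> = t ^ Suc q * of_nat ((Suc k + q) choose Suc q) + (?g y +
      (\<Sum>d\<le>q. of_nat (y choose d) * of_nat ((Suc k + q) choose (Suc k + d)) * t ^ (q - d)))"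
      by (simp only: IH Suc.IH add.assoc)
    also have "?g y + (\<Sum>d\<le>q. of_nat (y choose d) * of_nat ((Suc k + q) choose (Suc k + d)) * t ^ (q - d)) = ?g (Suc y)"
      by (simp add: algebra_simps flip: sum.distrib)
    finally show ?case .
  qed
  moreover have "row_gf (Suc (Suc q)) (csspp_cell k t) (Suc (k + y)) = (\<Sum>e\<le>Suc (k + y). ?r e)"
    unfolding row_gf.simps(2)[of "Suc q"] csspp_cell_Suc
    by (simp add: csspp_cell_def del: row_gf.simps)
  moreover have "(Suc k + q) choose Suc q = (k + Suc q) choose k"
    using binomial_symmetric[of k "k + Suc q"] by simp
  ultimately show ?case
    by (simp only: sum.atMost_Suc_shift) (simp add: mult_ac)
qed

text \<open>A list entry is one less than the row length or diagonal value it stands for. This fits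
  Frobenius coordinates, lets matrix indices start at \<open>0\<close> and makes every listed row
  nonempty.\<close>

definition list_shape :: "nat list \<Rightarrow> nat \<Rightarrow> nat" where
  "list_shape xs i = (if 1 \<le> i \<and> i \<le> length xs then Suc (xs ! (i - 1)) else 0)"

lemma strict_upto_list_shape: "sorted_wrt (>) xs \<Longrightarrow> strict_upto (length xs) (list_shape xs)"
  by (auto simp: strict_upto_def list_shape_def sorted_wrt_iff_nth_less)

lemma sum_list_shape_fillings:
  fixes w :: "nat \<Rightarrow> nat \<Rightarrow> 'a::comm_ring_1"
  assumes "sorted_wrt (>) ps" "sorted_wrt (>) ds" "length ps = length ds" "\<And>c. w c 0 = 0"
  shows "(\<Sum>F\<in>shifted_fillings (list_shape ps) (list_shape ds). filling_weight (list_shape ps) w F) =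
    minor (\<lambda>x q. row_gf (Suc q) w (Suc x)) ds ps"
proof -
  have "strict_upto (length ds) (list_shape ps)" using strict_upto_list_shape[OF assms(1)] assms(3) by simp
  from sum_shifted_fillings(2)[OF this strict_upto_list_shape[OF assms(2)], of w, OF assms(4)]
  show ?thesis
    unfolding minor_def
    by (rule trans) (rule det_mat_cong, simp add: list_shape_def assms(3) del: row_gf.simps)
qed

definition fillings_where ::
    "(nat \<Rightarrow> nat \<Rightarrow> bool) \<Rightarrow> (nat \<Rightarrow> nat) \<Rightarrow> (nat \<Rightarrow> nat) \<Rightarrow> (nat \<Rightarrow> nat \<Rightarrow> nat) set" where
  "fillings_where P p d = {F \<in> shifted_fillings p d. \<forall>(i, j)\<in>shifted_diagram p. P (j - i) (F i j)}"

lemma finite_list_shape_fillings: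
  assumes "sorted_wrt (>) ps" "sorted_wrt (>) ds" "length ps = length ds"
  shows "finite (shifted_fillings (list_shape ps) (list_shape ds))"
proof -
  have "strict_upto (length ds) (list_shape ps)" using strict_upto_list_shape[OF assms(1)] assms(3) by simp
  \<comment> \<open>Finiteness involves no weight; the zero weight over the integers merely
    instantiates the lemma.\<close>
  from sum_shifted_fillings(1)[OF this strict_upto_list_shape[OF assms(2)], of "\<lambda>_ _. 0 :: int"]
  show ?thesis by simp
qed

lemma finite_shifted_diagram_list_shape:
  "sorted_wrt (>) ps \<Longrightarrow> finite (shifted_diagram (list_shape ps))"
  by (rule finite_shifted_diagram_strict[OF strict_upto_list_shape])

lemma card_fillings_where:
  assumes "sorted_wrt (>) ps" "sorted_wrt (>) ds" "length ps = length ds" "\<And>c. \<not> P c 0"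
  shows "(of_nat (card (fillings_where P (list_shape ps) (list_shape ds))) :: 'a::comm_ring_1) =
    minor (\<lambda>x q. row_gf (Suc q) (\<lambda>c e. if P c e then 1 else 0) (Suc x)) ds ps"
proof -
  let ?S = "shifted_fillings (list_shape ps) (list_shape ds)"
  have "filling_weight (list_shape ps) (\<lambda>c e. if P c e then 1 else 0) F =
    (if F \<in> fillings_where P (list_shape ps) (list_shape ds) then 1 else 0 :: 'a)" if F: "F \<in> ?S" for F
  proof (cases "F \<in> fillings_where P (list_shape ps) (list_shape ds)")
    case True
    then show ?thesis by (auto simp: filling_weight_def fillings_where_def intro!: prod.neutral)
  next
    case False
    then obtain i j where "(i, j) \<in> shifted_diagram (list_shape ps)" "\<not> P (j - i) (F i j)"
      using F by (auto simp: fillings_where_def)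
    then have "\<exists>x\<in>shifted_diagram (list_shape ps).
      (case x of (i, j) \<Rightarrow> (if P (j - i) (F i j) then 1 else 0 :: 'a)) = 0" by force
    then show ?thesis using False
      unfolding filling_weight_def by (simp add: prod_zero[OF finite_shifted_diagram_list_shape[OF assms(1)]])
  qed
  then have "(\<Sum>F\<in>?S. filling_weight (list_shape ps) (\<lambda>c e. if P c e then 1 else 0) F) =
    (\<Sum>F\<in>?S. if F \<in> fillings_where P (list_shape ps) (list_shape ds) then 1 else 0 :: 'a)"
    by (rule sum.cong[OF refl])
  also have "\<dots> = of_nat (card (fillings_where P (list_shape ps) (list_shape ds)))"
    using finite_list_shape_fillings[OF assms(1-3)]
    by (subst sum.inter_filter[symmetric]) (auto simp: fillings_where_def intro!: arg_cong[of _ _ card])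
  finally show ?thesis
    using sum_list_shape_fillings[OF assms(1-3), of "\<lambda>c e. if P c e then 1 else 0 :: 'a"] assms(4) by simp
qed

lemma card_positive_fillings:
  assumes "sorted_wrt (>) ps" "sorted_wrt (>) ds" "length ps = length ds"
  shows "(of_nat (card (fillings_where (\<lambda>c e. 0 < e) (list_shape ps) (list_shape ds))) :: 'a::comm_ring_1) =
    minor (\<lambda>x q. of_nat ((x + q) choose q)) ds ps"
  using card_fillings_where[OF assms, of "\<lambda>c e. 0 < e"] by (simp only: row_gf_positive) simp

lemma card_offset_fillings:
  assumes "sorted_wrt (>) ps" "sorted_wrt (>) ds" "length ps = length ds"
  shows "(of_nat (card (fillings_where (<) (list_shape ps) (list_shape ds))) :: 'a::comm_ring_1) =
    minor (\<lambda>x q. of_nat (x choose q)) ds ps"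
proof -
  have eq: "row_gf (Suc q) (\<lambda>c e. if c < e then 1 else 0) (Suc x) = (of_nat (x choose q) :: 'a)" for q x
    using row_gf_above_offset[of q 0 "Suc x"] by (simp del: row_gf.simps)
  show ?thesis using card_fillings_where[OF assms, of "(<)", where 'a = 'a] by (simp only: eq)
qed

section \<open>Column strict shifted plane partitions\<close>

lemma list_shape_inject: "list_shape xs = list_shape ys \<longleftrightarrow> xs = ys"
proof
  assume eq: "list_shape xs = list_shape ys"
  have "{i. list_shape zs i \<noteq> 0} = {1..length zs}" for zs by (auto simp: list_shape_def)
  then have "{1..length xs} = {1..length ys}" using eq by metis
  then have len: "length xs = length ys" by (metis card_atLeastAtMost diff_Suc_1)
  show "xs = ys"
  proof (rule nth_equalityI[OF len])
    fix i assume "i < length xs"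
    then show "xs ! i = ys ! i" using fun_cong[OF eq, of "Suc i"] len by (simp add: list_shape_def)
  qed
qed simp

lemma list_shape_map_add:
  "list_shape (map (\<lambda>x. x + k) xs) i = (if 0 < list_shape xs i then list_shape xs i + k else 0)"
  by (auto simp: list_shape_def)

lemma strict_partition_list_shape:
  assumes "sorted_wrt (>) xs"
  shows "strict_partition (list_shape xs)"
proof -
  let ?p = "list_shape xs" and ?l = "length xs"
  note p = strict_upto_list_shape[OF assms]
  have s: "?p (Suc i) < ?p i" if "1 \<le> i" "0 < ?p i" for i
  proof (cases "Suc i \<le> ?l")
    case True
    then show ?thesis using strict_upto_less[OF p, of i "Suc i"] that by simp
  next
    case False
    then have "?p (Suc i) = 0" by (simp add: list_shape_def)
    then show ?thesis using that by simp
  qed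
  have "?p (Suc i) \<le> ?p i" if "1 \<le> i" for i
  proof (cases "?p i = 0")
    case True
    then have "?p (Suc i) = 0" using that by (auto simp: list_shape_def split: if_splits)
    then show ?thesis by simp
  qed (use s[OF that] in simp)
  moreover have "finite {i. ?p i \<noteq> 0}"
    by (rule finite_subset[of _ "{..?l}"]) (auto simp: list_shape_def)
  ultimately show ?thesis using s by (simp add: strict_partition_def is_partition_def list_shape_def)
qed

lemma strict_partition_ex_list_shape:
  assumes "strict_partition p"
  obtains xs where "sorted_wrt (>) xs" "p = list_shape xs"
proof -
  have p: "is_partition p" and st: "\<And>i. 1 \<le> i \<Longrightarrow> 0 < p i \<Longrightarrow> p (Suc i) < p i"
    using assms by (auto simp: strict_partition_def)
  define l where "l = Defs.conjugate p 1"
  have l: "i \<le> l \<longleftrightarrow> 1 \<le> p i" if "1 \<le> i" for i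
    unfolding l_def by (rule le_conjugate_iff[OF p that]) simp
  define xs where "xs = map (\<lambda>i. p (Suc i) - 1) [0..<l]"
  have "p (Suc j) < p (Suc i)" if "i < j" "j < l" for i j
    using st[of "Suc i"] l[of "Suc i"] that partition_antimono[OF p, of "Suc (Suc i)" "Suc j"] by simp
  moreover have "1 \<le> p (Suc j)" if "j < l" for j
    using l[of "Suc j"] that by simp
  ultimately have "sorted_wrt (>) xs"
    by (auto simp: xs_def sorted_wrt_iff_nth_less intro!: diff_less_mono)
  moreover have "p i = list_shape xs i" for i
    using l[of i] p by (cases i) (auto simp: list_shape_def xs_def is_partition_def)
  ultimately show ?thesis using that by blast
qed

lemma filling_weight_csspp_cell:
  assumes "finite (shifted_diagram p)"
  shows "filling_weight p (csspp_cell k t) F =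
    (if \<forall>(i, j)\<in>shifted_diagram p. 0 < F i j then t ^ csspp_mu k p F else 0)"
proof (cases "\<forall>(i, j)\<in>shifted_diagram p. 0 < F i j")
  case True
  have "filling_weight p (csspp_cell k t) F =
    (\<Prod>x\<in>shifted_diagram p. if (case x of (i, j) \<Rightarrow> F i j \<le> k + j - i) then t else 1)"
    unfolding filling_weight_def
  proof (rule prod.cong[OF refl])
    fix x assume "x \<in> shifted_diagram p"
    then show "(case x of (i, j) \<Rightarrow> csspp_cell k t (j - i) (F i j)) =
      (if (case x of (i, j) \<Rightarrow> F i j \<le> k + j - i) then t else 1)"
      using bspec[OF True, of x] by (auto simp: csspp_cell_def shifted_diagram_def)
  qed
  also have "\<dots> = t ^ csspp_mu k p F"
    by (simp add: prod.inter_filter[OF assms, symmetric] csspp_mu_def case_prod_beta' Collect_case_prod)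
  finally show ?thesis using True by simp
next
  case False
  then obtain i j where "(i, j) \<in> shifted_diagram p" "F i j = 0" by auto
  then have "\<exists>x\<in>shifted_diagram p. (case x of (i, j) \<Rightarrow> csspp_cell k t (j - i) (F i j)) = 0"
    by (force simp: csspp_cell_def)
  then have "filling_weight p (csspp_cell k t) F = 0"
    unfolding filling_weight_def by (rule prod_zero[OF assms])
  then show ?thesis using False by (simp only: if_False)
qed

text \<open>Being of class \<open>k\<close> means that the diagonal is the shape raised by
  \<open>k\<close> on nonempty rows, so the shape determines the diagonal. The bound on the first
  row bounds the whole list because it decreases.\<close>

lemma CSSPP_iff:
  assumes "sorted_wrt (>) xs"
  shows "(list_shape xs, F) \<in> CSSPP n k \<longleftrightarrow> set xs \<subseteq> {..<n} \<and>
    F \<in> fillings_where (\<lambda>c e. 0 < e) (list_shape xs) (list_shape (map (\<lambda>x. x + k) xs))"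
proof -
  let ?p = "list_shape xs"
  have diag: "(i, i) \<in> shifted_diagram ?p \<longleftrightarrow> 0 < ?p i" for i
    by (cases "i = 0") (auto simp: shifted_diagram_def list_shape_def)
  have le: "?p 1 \<le> n \<longleftrightarrow> set xs \<subseteq> {..<n}"
  proof (cases xs)
    case (Cons y ys)
    then have "\<forall>z\<in>set ys. z < y" using assms by simp
    then show ?thesis using Cons by (fastforce simp: list_shape_def)
  qed (simp add: list_shape_def)
  have "(\<forall>i. 0 < ?p i \<longrightarrow> F i i = ?p i + k) \<longleftrightarrow> (\<forall>i. F i i = list_shape (map (\<lambda>x. x + k) xs) i)"
    if "\<forall>i j. (i, j) \<notin> shifted_diagram ?p \<longrightarrow> F i j = 0"
    unfolding list_shape_map_add using that diag by auto
  then show ?thesis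
    unfolding CSSPP_def is_csspp_def fillings_where_def shifted_fillings_def
    using strict_partition_list_shape[OF assms] le by auto
qed

text \<open>Shape and diagonal come from one list, up to the shift by \<open>k\<close>, which makes
  the minors principal. Row \<open>i\<close> stands for the diagonal value
  \<open>Suc (k + i)\<close>, column \<open>j\<close> for the row length
  \<open>Suc j\<close>.\<close>

lemma csspp_gf_eq_minor_gf:
  "csspp_gf n k r t = minor_gf n r (\<lambda>i j.
    \<Sum>d\<le>j. of_nat (i choose d) * of_nat ((k + j) choose (k + d)) * t ^ (j - d))"
proof -
  let ?d = "\<lambda>xs. list_shape (map (\<lambda>x. x + k) xs)"
  let ?F = "\<lambda>xs. fillings_where (\<lambda>c e. 0 < e) (list_shape xs) (?d xs)"
  have sorted: "sorted_wrt (>) xs" if "xs \<in> decr_lists n" for xs using that by (simp add: decr_lists_def)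
  have sorted': "sorted_wrt (>) (map (\<lambda>x. x + k) xs)" if "xs \<in> decr_lists n" for xs
    using sorted[OF that] by (simp add: sorted_wrt_map)
  note fin = finite_list_shape_fillings[OF sorted sorted']
  have bij: "bij_betw (\<lambda>(xs, F). (list_shape xs, F)) (SIGMA xs:decr_lists n. ?F xs) (CSSPP n k)"
    unfolding bij_betw_def
  proof
    show "inj_on (\<lambda>(xs, F). (list_shape xs, F)) (SIGMA xs:decr_lists n. ?F xs)"
      by (auto simp: inj_on_def list_shape_inject)
    show "(\<lambda>(xs, F). (list_shape xs, F)) ` (SIGMA xs:decr_lists n. ?F xs) = CSSPP n k"
    proof (intro equalityI subsetI)
      fix x assume "x \<in> (\<lambda>(xs, F). (list_shape xs, F)) ` (SIGMA xs:decr_lists n. ?F xs)"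
      then show "x \<in> CSSPP n k" by (auto simp: CSSPP_iff decr_lists_def)
    next
      fix x assume x: "x \<in> CSSPP n k"
      then obtain p F where pF: "x = (p, F)" "strict_partition p"
        by (auto simp: CSSPP_def is_csspp_def)
      then obtain xs where xs: "sorted_wrt (>) xs" "p = list_shape xs"
        using strict_partition_ex_list_shape by blast
      then have "xs \<in> decr_lists n" "F \<in> ?F xs"
        using x pF CSSPP_iff[OF xs(1)] by (auto simp: decr_lists_def)
      then show "x \<in> (\<lambda>(xs, F). (list_shape xs, F)) ` (SIGMA xs:decr_lists n. ?F xs)"
        using pF xs by force
    qed
  qed
  have rows: "csspp_rows (list_shape xs) = length xs" for xs
  proof -
    have "{i. list_shape xs i > 0} = {1..length xs}" by (auto simp: list_shape_def)
    then show ?thesis by (simp add: csspp_rows_def)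
  qed
  have "csspp_gf n k r t =
    (\<Sum>(xs, F)\<in>(SIGMA xs:decr_lists n. ?F xs). r ^ length xs * t ^ csspp_mu k (list_shape xs) F)"
    unfolding csspp_gf_def
    by (subst sum.reindex_bij_betw[OF bij, symmetric]) (auto simp: rows intro!: sum.cong)
  also have "\<dots> = (\<Sum>xs\<in>decr_lists n. \<Sum>F\<in>?F xs. r ^ length xs * t ^ csspp_mu k (list_shape xs) F)"
    by (rule sum.Sigma[symmetric]) (use fin in \<open>auto simp: finite_decr_lists fillings_where_def\<close>)
  also have "\<dots> = (\<Sum>xs\<in>decr_lists n. r ^ length xs * minor (\<lambda>i j.
    \<Sum>d\<le>j. of_nat (i choose d) * of_nat ((k + j) choose (k + d)) * t ^ (j - d)) xs xs)"
  proof (rule sum.cong[OF refl])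
    fix xs assume xs: "xs \<in> decr_lists n"
    have "(\<Sum>F\<in>?F xs. t ^ csspp_mu k (list_shape xs) F) =
      (\<Sum>F\<in>shifted_fillings (list_shape xs) (?d xs). filling_weight (list_shape xs) (csspp_cell k t) F)"
      unfolding fillings_where_def
      by (simp add: sum.inter_filter[OF fin[OF xs xs]] filling_weight_csspp_cell
          finite_shifted_diagram_list_shape[OF sorted[OF xs]])
    also have "\<dots> = minor (\<lambda>x q. row_gf (Suc q) (csspp_cell k t) (Suc x)) (map (\<lambda>x. x + k) xs) xs"
      by (rule sum_list_shape_fillings[OF sorted[OF xs] sorted'[OF xs]]) (simp_all add: csspp_cell_def)
    also have "\<dots> = minor (\<lambda>i j. row_gf (Suc j) (csspp_cell k t) (Suc (k + i))) xs xs"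
      unfolding minor_def by (simp only: length_map) (rule det_mat_cong, simp add: add.commute del: row_gf.simps)
    also have "\<dots> = minor (\<lambda>i j.
      \<Sum>d\<le>j. of_nat (i choose d) * of_nat ((k + j) choose (k + d)) * t ^ (j - d)) xs xs"
      by (simp only: row_gf_csspp_cell_gt)
    finally show "(\<Sum>F\<in>?F xs. r ^ length xs * t ^ csspp_mu k (list_shape xs) F) =
      r ^ length xs * minor (\<lambda>i j.
      \<Sum>d\<le>j. of_nat (i choose d) * of_nat ((k + j) choose (k + d)) * t ^ (j - d)) xs xs"
      by (simp add: sum_distrib_left[symmetric])
  qed
  finally show ?thesis by (simp only: minor_gf_def)
qed

section \<open>Totally symmetric plane partitions\<close>

text \<open>Beyond the Durfee square \<open>q i < i\<close>, so the truncated differences are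
  \<open>0\<close>, as is \<open>list_shape\<close> past the end of the list.\<close>

lemma frobenius_list_shape:
  assumes q: "is_partition q" and f: "frobenius q = (as, bs)" and i: "1 \<le> i"
  shows "list_shape as i = Suc (q i) - i" "list_shape bs i = Suc (Defs.conjugate q i) - i"
proof -
  have ab: "as = map (\<lambda>i. q i - i) [1..<Suc (durfee q)]"
    "bs = map (\<lambda>i. Defs.conjugate q i - i) [1..<Suc (durfee q)]"
    using f by (auto simp: frobenius_def)
  have "i \<le> durfee q \<longleftrightarrow> i \<le> q i" by (rule le_durfee_iff[OF q])
  moreover have "i \<le> Defs.conjugate q i \<longleftrightarrow> i \<le> q i" by (rule le_conjugate_iff[OF q i i])
  ultimately show "list_shape as i = Suc (q i) - i" "list_shape bs i = Suc (Defs.conjugate q i) - i"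
    using i by (auto simp: list_shape_def ab simp del: upt_Suc)
qed

lemma shifted_diagram_list_shape_inject:
  assumes "shifted_diagram (list_shape xs) = shifted_diagram (list_shape ys)"
  shows "xs = ys"
proof -
  have "list_shape zs i = card {j. (i, j) \<in> shifted_diagram (list_shape zs)}" if "1 \<le> i" for zs i
  proof -
    have "{j. (i, j) \<in> shifted_diagram (list_shape zs)} = {i..<i + list_shape zs i}"
      using that by (auto simp: shifted_diagram_def)
    then show ?thesis by simp
  qed
  then have "list_shape xs i = list_shape ys i" for i
    using assms by (cases "i = 0") (auto simp: list_shape_def)
  then show ?thesis using list_shape_inject by blast
qed

lemma TSPP_symmetric:
  assumes "T \<in> TSPP m" "1 \<le> c" "c \<le> T i j"
  shows "1 \<le> i" "1 \<le> j" "c \<le> T j i" "j \<le> T i c" "i \<le> T c j" "i \<le> T j c" "j \<le> T c i"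
proof -
  have z: "T i j = 0" if "\<not> (1 \<le> i \<and> i \<le> m \<and> 1 \<le> j \<and> j \<le> m)"
    using assms(1) that unfolding TSPP_def by blast
  then have "(i, j, c) \<in> plane_cells m T" using assms(2,3) by (auto simp: plane_cells_def)
  then have "(i, c, j) \<in> plane_cells m T \<and> (j, i, c) \<in> plane_cells m T \<and>
        (j, c, i) \<in> plane_cells m T \<and> (c, i, j) \<in> plane_cells m T \<and> (c, j, i) \<in> plane_cells m T"
    using assms(1) unfolding TSPP_def by blast
  then show "1 \<le> i" "1 \<le> j" "c \<le> T j i" "j \<le> T i c" "i \<le> T c j" "i \<le> T j c" "j \<le> T c i"
    by (auto simp: plane_cells_def)
qed

lemma TSPP_row: "T \<in> TSPP m \<Longrightarrow> 1 \<le> j \<Longrightarrow> T i (Suc j) \<le> T i j"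
proof -
  assume T: "T \<in> TSPP m" "1 \<le> j"
  have "T i (Suc j) = 0" if "\<not> (1 \<le> i \<and> i \<le> m \<and> Suc j \<le> m)"
    using T(1) that unfolding TSPP_def by blast
  moreover have "\<forall>i\<in>{1..m}. \<forall>j\<in>{1..<m}. T i (Suc j) \<le> T i j"
    using T(1) unfolding TSPP_def by blast
  ultimately show ?thesis using T(2) by (cases "1 \<le> i \<and> i \<le> m \<and> Suc j \<le> m") auto
qed

lemma TSPP_column:
  assumes T: "T \<in> TSPP m" and i: "1 \<le> i"
  shows "T (Suc i) j \<le> T i j"
proof (cases "T (Suc i) j = 0")
  case False
  then have "T (Suc i) j \<le> T j (Suc i)" using TSPP_symmetric(3)[OF T, of "T (Suc i) j"] by simp
  also have "\<dots> \<le> T j i" by (rule TSPP_row[OF T i])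
  finally show ?thesis using TSPP_symmetric(3)[OF T, of "T (Suc i) j" j i] False by simp
qed simp

text \<open>Since \<open>tspp_diag T\<close> is conjugate to the diagonal of \<open>T\<close>, the
  inequality \<open>j \<le> tspp_diag T i\<close> says that \<open>(j, j, i)\<close> is a cell,
  equivalently that \<open>(i, j, j)\<close> is one.\<close>

lemma TSPP_list_shape:
  assumes T: "T \<in> TSPP m" and f: "frobenius (tspp_diag T) = (as, bs)"
  shows "(i, j) \<in> shifted_diagram (list_shape as) \<longleftrightarrow> 1 \<le> i \<and> i \<le> j \<and> j \<le> T i j"
    and "1 \<le> i \<Longrightarrow> list_shape bs i = Suc (T i i) - i"
proof -
  note D = TSPP_diagonal_partition[OF T]
  note q = partition_tspp_diag[OF T]
  show "(i, j) \<in> shifted_diagram (list_shape as) \<longleftrightarrow> 1 \<le> i \<and> i \<le> j \<and> j \<le> T i j"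
  proof (cases "1 \<le> i \<and> i \<le> j")
    case True
    have "(i, j) \<in> shifted_diagram (list_shape as) \<longleftrightarrow> j \<le> tspp_diag T i"
      using frobenius_list_shape(1)[OF q f, of i] True by (auto simp: shifted_diagram_def)
    also have "\<dots> \<longleftrightarrow> i \<le> T j j"
      unfolding tspp_diag_def by (rule le_conjugate_iff[OF D]) (use True in auto)
    also have "\<dots> \<longleftrightarrow> j \<le> T i j"
      using TSPP_symmetric(5)[OF T, of i j j] TSPP_symmetric(5)[OF T, of j i j] True by auto
    finally show ?thesis using True by simp
  qed (auto simp: shifted_diagram_def)
  have "Defs.conjugate (tspp_diag T) = (\<lambda>i. T i i)"
    unfolding tspp_diag_def by (rule conjugate_conjugate[OF D])
  then show "list_shape bs i = Suc (T i i) - i" if "1 \<le> i"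
    using frobenius_list_shape(2)[OF q f that] by simp
qed

text \<open>A totally symmetric plane partition is determined by its cells with sorted coordinates
  \<open>i \<le> j \<le> c\<close>, of which there are \<open>T i j - j + 1\<close> above \<open>(i, j)\<close>; adding \<open>j - i\<close> makes the columns
  strict. Conversely, \<open>symmetric_cell G i j c\<close> states that the sorted triple lies below \<open>G\<close>.\<close>

definition tspp_filling :: "(nat \<Rightarrow> nat \<Rightarrow> nat) \<Rightarrow> nat \<Rightarrow> nat \<Rightarrow> nat" where
  "tspp_filling T i j = (if 1 \<le> i \<and> i \<le> j \<and> j \<le> T i j then Suc (T i j) - i else 0)"

text \<open>The median, that is, the middle coordinate of the sorted triple.\<close>

definition mid :: "nat \<Rightarrow> nat \<Rightarrow> nat \<Rightarrow> nat" where
  "mid i j c = max (min i j) (min (max i j) c)"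

lemma mid_swap: "mid j i c = mid i j c" "mid i c j = mid i j c"
  by (auto simp: mid_def min_def max_def)

lemma mid_mono: "c' \<le> c \<Longrightarrow> mid i j c' \<le> mid i j c"
  by (auto simp: mid_def min_def max_def)

lemma mid_bounds: "min (min i j) c \<le> mid i j c" "mid i j c \<le> max (max i j) c"
  by (auto simp: mid_def min_def max_def)

definition symmetric_cell :: "(nat \<Rightarrow> nat \<Rightarrow> nat) \<Rightarrow> nat \<Rightarrow> nat \<Rightarrow> nat \<Rightarrow> bool" where
  "symmetric_cell G i j c \<longleftrightarrow> 1 \<le> min (min i j) c \<and>
     max (max i j) c < G (min (min i j) c) (mid i j c) + min (min i j) c"

lemma symmetric_cell_swap:
  "symmetric_cell G j i c = symmetric_cell G i j c" "symmetric_cell G i c j = symmetric_cell G i j c"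
proof -
  have "min (min i c) j = min (min i j) c" "max (max i c) j = max (max i j) c"
    by (auto simp: min_def max_def)
  then show "symmetric_cell G j i c = symmetric_cell G i j c" "symmetric_cell G i c j = symmetric_cell G i j c"
    unfolding symmetric_cell_def by (simp_all add: mid_swap min.commute[of i j] max.commute[of i j])
qed

lemma symmetric_cell_sorted:
  "1 \<le> i \<Longrightarrow> i \<le> j \<Longrightarrow> j \<le> c \<Longrightarrow> symmetric_cell G i j c \<longleftrightarrow> c < G i j + i"
  by (simp add: symmetric_cell_def mid_def min_def max_def)

text \<open>The cells of \<open>T\<close> can be read off its filling, which makes
  \<open>tspp_filling\<close> injective on \<open>TSPP m\<close>. Both sides are symmetric in the
  three coordinates, so sorted triples suffice.\<close>

lemma symmetric_cell_tspp_filling: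
  assumes T: "T \<in> TSPP m" and c: "1 \<le> c"
  shows "symmetric_cell (tspp_filling T) i j c \<longleftrightarrow> c \<le> T i j"
proof -
  have sorted: "symmetric_cell (tspp_filling T) x y z \<longleftrightarrow> z \<le> T x y"
    if "1 \<le> x" "x \<le> y" "y \<le> z" for x y z
    using that by (auto simp: symmetric_cell_sorted tspp_filling_def)
  have sym: "z \<le> T x y \<longleftrightarrow> z \<le> T y x" "z \<le> T x y \<longleftrightarrow> y \<le> T x z"
    if "1 \<le> x" "1 \<le> y" "1 \<le> z" for x y z
    using TSPP_symmetric(3,4)[OF T] that by blast+
  show ?thesis
  proof (cases "1 \<le> i \<and> 1 \<le> j")
    case True
    then have pos: "1 \<le> i" "1 \<le> j" by auto
    let ?c = "symmetric_cell (tspp_filling T)"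
    have swap1: "?c y x z = ?c x y z" and swap2: "?c x z y = ?c x y z" for x y z
      by (rule symmetric_cell_swap)+
    consider "i \<le> j" "j \<le> c" | "i \<le> c" "c \<le> j" | "j \<le> i" "i \<le> c" | "j \<le> c" "c \<le> i"
      | "c \<le> i" "i \<le> j" | "c \<le> j" "j \<le> i" by linarith
    then show ?thesis
    proof cases
      case 1
      then show ?thesis using sorted pos by blast
    next
      case 2
      then have "?c i c j \<longleftrightarrow> j \<le> T i c" using sorted pos by blast
      then show ?thesis using sym(2)[of i j c] swap2[of i c j] pos c by blast
    next
      case 3
      then have "?c j i c \<longleftrightarrow> c \<le> T j i" using sorted pos by blast
      then show ?thesis using sym(1)[of i j c] swap1[of i j c] pos c by blast
    next
      case 4
      then have "?c j c i \<longleftrightarrow> i \<le> T j c" using sorted pos by blast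
      then show ?thesis
        using sym(1)[of i j c] sym(2)[of j i c] swap1[of i j c] swap2[of j c i] pos c by blast
    next
      case 5
      then have "?c c i j \<longleftrightarrow> j \<le> T c i" using sorted c by blast
      then show ?thesis
        using sym(2)[of i j c] sym(1)[of i c j] swap2[of i c j] swap1[of i c j] pos c by blast
    next
      case 6
      then have "?c c j i \<longleftrightarrow> i \<le> T c j" using sorted c by blast
      then show ?thesis
        using sym(1)[of i j c] sym(2)[of j i c] sym(1)[of j c i] swap1[of i j c] swap2[of j c i]
          swap1[of j c i] pos c by blast
    qed
  next
    case False
    then show ?thesis using TSPP_symmetric(1,2)[OF T c, of i j] by (auto simp: symmetric_cell_def)
  qed
qed

lemma down_closed_eq_interval:
  fixes A :: "nat set"
  assumes "finite A" "\<And>c. c \<in> A \<Longrightarrow> 1 \<le> c" "\<And>c c'. c \<in> A \<Longrightarrow> 1 \<le> c' \<Longrightarrow> c' \<le> c \<Longrightarrow> c' \<in> A"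
  shows "A = {1..card A}"
proof (cases "A = {}")
  case False
  have "A = {1..Max A}"
  proof (intro equalityI subsetI)
    fix c assume "c \<in> {1..Max A}"
    then show "c \<in> A" using assms(3)[OF Max_in[OF assms(1) False], of c] by simp
  qed (use assms(2) Max_ge[OF assms(1)] in auto)
  then show ?thesis by (metis card_atLeastAtMost diff_Suc_1)
qed simp

text \<open>The bijection is \<open>tspp_filling\<close>; its inverse puts above
  \<open>(i, j)\<close> all cells whose sorted triples lie below \<open>G\<close>. The condition
  \<open>(<)\<close> reflects \<open>j \<le> T i j\<close>, and the bound on \<open>bs\<close> keeps
  the cells inside the box of side \<open>m\<close>.\<close>

lemma card_TSPP_frobenius:
  assumes as: "sorted_wrt (>) as" and bs: "sorted_wrt (>) bs" "set bs \<subseteq> {..<m}" and len: "length as = length bs"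
  shows "card {T \<in> TSPP m. frobenius (tspp_diag T) = (as, bs)} =
    card (fillings_where (<) (list_shape as) (list_shape bs))"
proof (rule bij_betw_same_card)
  let ?S = "{T \<in> TSPP m. frobenius (tspp_diag T) = (as, bs)}"
  let ?F = "fillings_where (<) (list_shape as) (list_shape bs)"
  show "bij_betw tspp_filling ?S ?F"
    unfolding bij_betw_def
  proof (intro conjI inj_onI equalityI subsetI)
    fix T T' assume T: "T \<in> ?S" "T' \<in> ?S" "tspp_filling T = tspp_filling T'"
    have "c \<le> T i j \<longleftrightarrow> c \<le> T' i j" for c i j
    proof (cases "c = 0")
      case False
      then show ?thesis
        using symmetric_cell_tspp_filling[of T m c i j] symmetric_cell_tspp_filling[of T' m c i j] T by simp
    qed simp
    then show "T = T'" by (intro ext antisym) blast+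
  next
    fix G assume "G \<in> tspp_filling ` ?S"
    then obtain T where G: "G = tspp_filling T" and T: "T \<in> TSPP m" and f: "frobenius (tspp_diag T) = (as, bs)"
      by auto
    note shape = TSPP_list_shape[OF T f]
    have "tspp_filling T i i = list_shape bs i" for i
      using shape(2)[of i] by (cases "1 \<le> i") (auto simp: tspp_filling_def list_shape_def)
    moreover have "tspp_filling T i j = 0" if "(i, j) \<notin> shifted_diagram (list_shape as)" for i j
      using that by (simp add: shape(1) tspp_filling_def)
    moreover have "tspp_filling T i (Suc j) \<le> tspp_filling T i j"
      if "(i, j) \<in> shifted_diagram (list_shape as)" "(i, Suc j) \<in> shifted_diagram (list_shape as)" for i j
      using that TSPP_row[OF T, of j i] by (simp add: shape(1) tspp_filling_def diff_le_mono)
    moreover have "tspp_filling T (Suc i) j < tspp_filling T i j"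
      if "(i, j) \<in> shifted_diagram (list_shape as)" "(Suc i, j) \<in> shifted_diagram (list_shape as)" for i j
      using that TSPP_column[OF T, of i j] by (simp add: shape(1) tspp_filling_def, linarith)
    moreover have "j - i < tspp_filling T i j" if "(i, j) \<in> shifted_diagram (list_shape as)" for i j
      using that by (simp add: shape(1) tspp_filling_def, linarith)
    ultimately show "G \<in> ?F" unfolding G fillings_where_def shifted_fillings_def by blast
  next
    fix G assume G: "G \<in> ?F"
    let ?D = "shifted_diagram (list_shape as)"
    have out: "G i j = 0" if "(i, j) \<notin> ?D" for i j
      using G that by (auto simp: fillings_where_def shifted_fillings_def)
    have diag: "G i i = list_shape bs i" for i
      using G by (auto simp: fillings_where_def shifted_fillings_def)
    have off: "j - i < G i j" if "(i, j) \<in> ?D" for i j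
      using G that by (auto simp: fillings_where_def)
    have st: "0 < list_shape as (Suc i) \<Longrightarrow> list_shape as (Suc i) < list_shape as i" if "1 \<le> i" for i
      using strict_partition_list_shape[OF as] that
      unfolding strict_partition_def is_partition_def by (metis le_less_linear le_zero_eq not_gr_zero)
    have row: "(i, j') \<in> ?D \<and> G i j \<le> G i j'" if "(i, j) \<in> ?D" "i \<le> j'" "j' \<le> j" for i j j'
      using that(3,1,2)
    proof (induction j rule: dec_induct)
      case (step j)
      then have "(i, j) \<in> ?D" by (auto simp: shifted_diagram_def)
      moreover from this have "G i (Suc j) \<le> G i j"
        using G step by (auto simp: fillings_where_def shifted_fillings_def)
      ultimately show ?case using step by auto
    qed simp
    \<comment> \<open>Strict columns make \<open>G i j + i\<close>, the quantity compared in
      \<open>symmetric_cell\<close>, weakly decreasing in \<open>i\<close>.\<close>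
    have col: "(i', j) \<in> ?D \<and> G i j + i \<le> G i' j + i'" if "(i, j) \<in> ?D" "1 \<le> i'" "i' \<le> i" for i j i'
      using that(3,1,2)
    proof (induction i rule: dec_induct)
      case (step i)
      then have "(i, j) \<in> ?D" using st[of i] by (auto simp: shifted_diagram_def)
      moreover from this have "G (Suc i) j < G i j"
        using G step by (auto simp: fillings_where_def shifted_fillings_def)
      ultimately show ?case using step by auto
    qed simp
    \<comment> \<open>Sorted triples below \<open>G\<close> form a down-set. As sorting is monotone,
      the symmetrised set of cells is a down-set too.\<close>
    have gmono: "z' < G x' y' + x'"
      if "z < G x y + x" "x \<le> y" "y \<le> z" "1 \<le> x'" "x' \<le> y'" "x' \<le> x" "y' \<le> y" "z' \<le> z" for x y z x' y' z'
    proof -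
      have "(x, y) \<in> ?D" using out[of x y] that by (cases "(x, y) \<in> ?D") auto
      from col[OF this that(4,6)] have "(x', y) \<in> ?D" "G x y + x \<le> G x' y + x'" by auto
      then show ?thesis using row[of x' y y'] that by auto
    qed
    have vmono: "symmetric_cell G i j c'" if "symmetric_cell G i j c" "1 \<le> c'" "c' \<le> c" for i j c c'
      unfolding symmetric_cell_def
    proof
      show pos: "1 \<le> min (min i j) c'" using that by (simp add: symmetric_cell_def)
      have "max (max i j) c < G (min (min i j) c) (mid i j c) + min (min i j) c"
        using that(1) by (simp add: symmetric_cell_def)
      then show "max (max i j) c' < G (min (min i j) c') (mid i j c') + min (min i j) c'"
        by (rule gmono[OF _ mid_bounds pos mid_bounds(1) _ mid_mono[OF that(3)]])
          (intro min.mono max.mono order_refl that(3))+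
    qed
    \<comment> \<open>The two smaller coordinates can be lowered to \<open>1\<close> while the
      largest is kept, so the largest is at most \<open>G 1 1\<close>, the first diagonal
      value.\<close>
    have bound: "i \<le> m \<and> j \<le> m \<and> c \<le> m" if "symmetric_cell G i j c" for i j c
    proof -
      let ?x = "min (min i j) c" and ?z = "max (max i j) c"
      have v: "?z < G ?x (mid i j c) + ?x" "1 \<le> ?x" using that by (auto simp: symmetric_cell_def)
      have "?z < G 1 1 + 1"
        by (rule gmono[OF v(1) mid_bounds le_refl le_refl v(2) order_trans[OF v(2) mid_bounds(1)] le_refl])
      moreover have "list_shape bs 1 \<le> m"
        using bs(2) by (cases bs) (auto simp: list_shape_def)
      ultimately show ?thesis using diag[of 1] by auto
    qed
    define T where "T i j = card {c. symmetric_cell G i j c}" for i j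
    have T: "c \<le> T i j \<longleftrightarrow> symmetric_cell G i j c" if "1 \<le> c" for i j c
    proof -
      have "{c. symmetric_cell G i j c} = {1..T i j}"
        unfolding T_def
      proof (rule down_closed_eq_interval)
        show "finite {c. symmetric_cell G i j c}"
          by (rule finite_subset[of _ "{..m}"]) (use bound in auto)
        show "1 \<le> c" if "c \<in> {c. symmetric_cell G i j c}" for c
          using that by (simp add: symmetric_cell_def)
        show "c' \<in> {c. symmetric_cell G i j c}"
          if "c \<in> {c. symmetric_cell G i j c}" "1 \<le> c'" "c' \<le> c" for c c'
          using vmono[of i j c c'] that by simp
      qed
      then show ?thesis using that by auto
    qed
    have top: "symmetric_cell G i j (T i j)" if "T i j \<noteq> 0" for i j
      using T[of "T i j" i j] that by simp
    have Tle: "T i j \<le> T i' j'" if "\<And>c. symmetric_cell G i j c \<Longrightarrow> symmetric_cell G i' j' c" for i j i' j'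
    proof (cases "T i j = 0")
      case False
      then show ?thesis using T[of "T i j" i' j'] that[OF top] by simp
    qed simp
    have vmono2: "symmetric_cell G i j c" if "symmetric_cell G i (Suc j) c" "1 \<le> j" for i j c
      using vmono[of i c "Suc j" j] that symmetric_cell_swap(2)[of G i] by simp
    have vmono1: "symmetric_cell G i j c" if "symmetric_cell G (Suc i) j c" "1 \<le> i" for i j c
      using vmono2[of j i c] that symmetric_cell_swap(1)[of G j] by simp
    have TT: "T \<in> TSPP m"
      unfolding TSPP_def
    proof (intro CollectI conjI allI ballI impI)
      fix i j assume "\<not> (1 \<le> i \<and> i \<le> m \<and> 1 \<le> j \<and> j \<le> m)"
      then have "\<not> symmetric_cell G i j (T i j)"
        using bound[of i j "T i j"] by (auto simp: symmetric_cell_def)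
      then show "T i j = 0" using top by blast
    next
      fix i j show "T i j \<le> m" using bound[OF top, of i j] by (cases "T i j = 0") simp_all
    next
      fix i j assume "i \<in> {1..m}" "j \<in> {1..<m}"
      then show "T i (Suc j) \<le> T i j" by (intro Tle, elim vmono2) simp
    next
      fix i j assume "i \<in> {1..<m}" "j \<in> {1..m}"
      then show "T (Suc i) j \<le> T i j" by (intro Tle, elim vmono1) simp
    next
      fix i j c
      have cells: "(x, y, z) \<in> plane_cells m T \<longleftrightarrow> symmetric_cell G x y z" for x y z
        using T[of z x y] bound[of x y z]
        by (cases "1 \<le> z") (auto simp: plane_cells_def symmetric_cell_def)
      assume a: "(i, j, c) \<in> plane_cells m T"
      note swap = symmetric_cell_swap[of G]
      show "(i, c, j) \<in> plane_cells m T" using a unfolding cells by (metis swap)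
      show "(j, i, c) \<in> plane_cells m T" using a unfolding cells by (metis swap)
      show "(j, c, i) \<in> plane_cells m T" using a unfolding cells by (metis swap)
      show "(c, i, j) \<in> plane_cells m T" using a unfolding cells by (metis swap)
      show "(c, j, i) \<in> plane_cells m T" using a unfolding cells by (metis swap)
    qed
    have mem: "(i, j) \<in> ?D \<longleftrightarrow> 1 \<le> i \<and> i \<le> j \<and> j \<le> T i j" for i j
    proof (cases "1 \<le> i \<and> i \<le> j")
      case True
      then have "j \<le> T i j \<longleftrightarrow> j < G i j + i" using T[of j i j] by (simp add: symmetric_cell_sorted)
      then show ?thesis using off[of i j] out[of i j] True by (cases "(i, j) \<in> ?D") auto
    qed (auto simp: shifted_diagram_def)
    have val: "Suc (T i j) - i = G i j" if "(i, j) \<in> ?D" for i j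
    proof -
      have ij: "1 \<le> i" "i \<le> j" "j \<le> T i j" using that mem by auto
      have *: "c \<le> T i j \<longleftrightarrow> c < G i j + i" if "j \<le> c" for c
        using T[of c i j] ij that by (simp add: symmetric_cell_sorted)
      have "T i j < G i j + i" using *[of "T i j"] ij by simp
      \<comment> \<open>By \<open>off\<close>, the number \<open>G i j + i - 1\<close> is at least
        \<open>j\<close>, so the equivalence above applies to it.\<close>
      moreover have "G i j + i - 1 \<le> T i j" using *[of "G i j + i - 1"] off[OF that] ij by auto
      ultimately show ?thesis using ij by linarith
    qed
    have GT: "tspp_filling T = G"
    proof (intro ext)
      fix i j show "tspp_filling T i j = G i j"
        using mem[of i j] val[of i j] out[of i j] by (auto simp: tspp_filling_def)
    qed
    obtain as' bs' where f: "frobenius (tspp_diag T) = (as', bs')" by (cases "frobenius (tspp_diag T)")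
    have "shifted_diagram (list_shape as') = ?D"
      using TSPP_list_shape(1)[OF TT f] mem by auto
    then have "as' = as" by (rule shifted_diagram_list_shape_inject)
    moreover have "list_shape bs' i = list_shape bs i" for i
    proof (cases "1 \<le> i")
      case True
      have "list_shape bs' i = Suc (T i i) - i" by (rule TSPP_list_shape(2)[OF TT f True])
      also have "\<dots> = tspp_filling T i i" using True by (auto simp: tspp_filling_def)
      finally show ?thesis using GT diag by simp
    qed (simp add: list_shape_def)
    then have "bs' = bs" using list_shape_inject by blast
    ultimately have "T \<in> ?S" using TT f by simp
    then show "G \<in> tspp_filling ` ?S" using GT by blast
  qed
qed

section \<open>Semistandard tableaux\<close>

lemma shifted_fillings_diag: "F \<in> shifted_fillings p d \<Longrightarrow> F i i = d i"
  by (simp add: shifted_fillings_def)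

lemma shifted_fillings_out: "F \<in> shifted_fillings p d \<Longrightarrow> (i, j) \<notin> shifted_diagram p \<Longrightarrow> F i j = 0"
  by (simp add: shifted_fillings_def)

lemma shifted_fillings_row:
  "F \<in> shifted_fillings p d \<Longrightarrow> (i, j) \<in> shifted_diagram p \<Longrightarrow> (i, Suc j) \<in> shifted_diagram p \<Longrightarrow>
    F i (Suc j) \<le> F i j"
  by (simp add: shifted_fillings_def)

lemma shifted_fillings_column:
  "F \<in> shifted_fillings p d \<Longrightarrow> (i, j) \<in> shifted_diagram p \<Longrightarrow> (Suc i, j) \<in> shifted_diagram p \<Longrightarrow>
    F (Suc i) j < F i j"
  by (simp add: shifted_fillings_def)

lemma shifted_fillings_le_diag:
  assumes F: "F \<in> shifted_fillings p d" and ij: "(i, j) \<in> shifted_diagram p"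
  shows "F i j \<le> d i"
proof -
  have "i \<le> j" using ij by (simp add: shifted_diagram_def)
  then show ?thesis using ij
  proof (induction j rule: dec_induct)
    case (step j)
    then have "(i, j) \<in> shifted_diagram p" by (auto simp: shifted_diagram_def)
    then show ?case using step shifted_fillings_row[OF F, of i j] by simp
  qed (simp add: shifted_fillings_diag[OF F])
qed

lemma SSYT_D:
  assumes "F \<in> SSYT q m"
  shows "(i, j) \<in> diagram q \<Longrightarrow> 1 \<le> F i j \<and> F i j \<le> m"
    and "(i, j) \<notin> diagram q \<Longrightarrow> F i j = 0"
    and "(i, j) \<in> diagram q \<Longrightarrow> (i, Suc j) \<in> diagram q \<Longrightarrow> F i j \<le> F i (Suc j)"
    and "(i, j) \<in> diagram q \<Longrightarrow> (Suc i, j) \<in> diagram q \<Longrightarrow> F i j < F (Suc i) j"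
  using assms by (simp_all add: SSYT_def)

text \<open>A semistandard tableau is cut along its diagonal. Complementing the entries turns the part weakly above
  the diagonal into a column strict shifted filling, and the transpose of the part weakly below
  it into a row strict one; the latter becomes column strict after adding \<open>j - i\<close>.\<close>

lemma card_SSYT_frobenius:
  assumes q: "is_partition q" and f: "frobenius q = (as, cs)"
  shows "card (SSYT q m) = (\<Sum>xs | xs \<in> decr_lists m \<and> length xs = length as.
    card (fillings_where (\<lambda>c e. 0 < e) (list_shape as) (list_shape xs)) *
    card (fillings_where (<) (list_shape cs) (list_shape xs)))"
proof -
  let ?X = "{xs. xs \<in> decr_lists m \<and> length xs = length as}"
  let ?U = "\<lambda>xs. fillings_where (\<lambda>c e. 0 < e) (list_shape as) (list_shape xs)"
  let ?L = "\<lambda>xs. fillings_where (<) (list_shape cs) (list_shape xs)"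
  let ?A = "shifted_diagram (list_shape as)" and ?C = "shifted_diagram (list_shape cs)"
  note st = frobenius_strict[OF q f]
  have A: "(i, j) \<in> ?A \<longleftrightarrow> i \<le> j \<and> (i, j) \<in> diagram q" for i j
  proof (cases "1 \<le> i \<and> i \<le> j")
    case True
    then show ?thesis using frobenius_list_shape(1)[OF q f, of i] by (auto simp: shifted_diagram_def diagram_def)
  qed (auto simp: shifted_diagram_def diagram_def)
  \<comment> \<open>The lower part is transposed, so the coordinates appear exchanged.\<close>
  have C: "(j, i) \<in> ?C \<longleftrightarrow> j \<le> i \<and> (i, j) \<in> diagram q" for i j
  proof (cases "1 \<le> j \<and> j \<le> i")
    case True
    then have "(j, i) \<in> ?C \<longleftrightarrow> i \<le> Defs.conjugate q j"
      using frobenius_list_shape(2)[OF q f, of j] by (auto simp: shifted_diagram_def)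
    also have "\<dots> \<longleftrightarrow> j \<le> q i" by (rule le_conjugate_iff[OF q]) (use True in auto)
    finally show ?thesis using True by (auto simp: diagram_def)
  qed (auto simp: shifted_diagram_def diagram_def)
  have Aii: "(i, i) \<in> ?A \<longleftrightarrow> 1 \<le> i \<and> i \<le> length as" for i
    by (auto simp: shifted_diagram_def list_shape_def)
  \<comment> \<open>Both parts contain the diagonal, with the same complemented values.
    \<open>dg\<close> lowers these by one to offset the \<open>Suc\<close> in
    \<open>list_shape\<close>.\<close>
  define up where "up F i j = (if (i, j) \<in> ?A then Suc m - F i j else 0)" for F and i j :: nat
  define low where "low F i j = (if (i, j) \<in> ?C then Suc m - F j i + (j - i) else 0)" for F and i j :: nat
  define dg where "dg F = map (\<lambda>i. m - F (Suc i) (Suc i)) [0..<length as]" for F :: "nat \<Rightarrow> nat \<Rightarrow> nat"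
  define glue where "glue U L i j = (if (i, j) \<notin> diagram q then 0 else
     if i \<le> j then Suc m - U i j else Suc m + (i - j) - L j i)" for U L and i j :: nat
  have ls_dg: "list_shape (dg F) i = up F i i" "(i, i) \<in> diagram q \<Longrightarrow> up F i i = low F i i"
    if "F \<in> SSYT q m" for F i
  proof -
    have F: "1 \<le> F i i \<and> F i i \<le> m" if "(i, i) \<in> ?A" for i
      using that SSYT_D(1)[OF \<open>F \<in> SSYT q m\<close>, of i i] A by blast
    show "list_shape (dg F) i = up F i i"
    proof (cases "(i, i) \<in> ?A")
      case True
      then show ?thesis using Aii[of i] F[of i]
        by (cases i) (auto simp: list_shape_def dg_def up_def Suc_diff_le)
    next
      case False
      then show ?thesis using Aii[of i] by (auto simp: list_shape_def dg_def up_def)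
    qed
    show "up F i i = low F i i" if "(i, i) \<in> diagram q"
      using that by (simp add: up_def low_def A C)
  qed
  have bij: "bij_betw (\<lambda>(xs, U, L). glue U L) (SIGMA xs:?X. ?U xs \<times> ?L xs) (SSYT q m)"
  proof (rule bij_betw_byWitness[where f' = "\<lambda>F. (dg F, up F, low F)"])
    show "\<forall>F\<in>SSYT q m. (\<lambda>(xs, U, L). glue U L) (dg F, up F, low F) = F"
    proof
      fix F assume F: "F \<in> SSYT q m"
      have "glue (up F) (low F) i j = F i j" for i j
        using SSYT_D(1,2)[OF F, of i j] A[of i j] C[of j i]
        by (cases "(i, j) \<in> diagram q") (auto simp: glue_def up_def low_def)
      then show "(\<lambda>(xs, U, L). glue U L) (dg F, up F, low F) = F" by auto
    qed
    show "(\<lambda>F. (dg F, up F, low F)) ` SSYT q m \<subseteq> (SIGMA xs:?X. ?U xs \<times> ?L xs)"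
    proof clarify
      fix F assume F: "F \<in> SSYT q m"
      note D = SSYT_D[OF F]
      have "m - F (Suc (Suc i)) (Suc (Suc i)) < m - F (Suc i) (Suc i)" if "Suc i < length as" for i
      proof -
        have d: "(Suc (Suc i), Suc (Suc i)) \<in> diagram q" "(Suc i, Suc (Suc i)) \<in> diagram q"
          using Aii[of "Suc (Suc i)"] Aii[of "Suc i"] that A q
          by (auto simp: diagram_def intro: order_trans[OF _ partition_antimono])
        then have d': "(Suc i, Suc i) \<in> diagram q" by (auto simp: diagram_def)
        have "F (Suc i) (Suc i) < F (Suc (Suc i)) (Suc (Suc i))"
          using D(3)[OF d' d(2)] D(4)[OF d(2,1)] by simp
        then show ?thesis using D(1)[OF d(1)] by linarith
      qed
      then have "sorted_wrt (>) (dg F)"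
        by (subst sorted_wrt_iff_nth_Suc_transp) (auto simp: dg_def transp_def)
      moreover have "m - F (Suc i) (Suc i) < m" if "i < length as" for i
        using D(1)[of "Suc i" "Suc i"] Aii[of "Suc i"] A that by fastforce
      ultimately have "dg F \<in> ?X" by (auto simp: decr_lists_def dg_def)
      moreover have "up F \<in> ?U (dg F)"
        unfolding fillings_where_def shifted_fillings_def
      proof (intro CollectI conjI allI impI ballI)
        fix i j
        show "up F i i = list_shape (dg F) i" using ls_dg(1)[OF F] by simp
        show "(i, j) \<notin> ?A \<Longrightarrow> up F i j = 0" by (simp add: up_def)
        show "(i, j) \<in> ?A \<and> (i, Suc j) \<in> ?A \<Longrightarrow> up F i (Suc j) \<le> up F i j"
          using D(3)[of i j] by (auto simp: up_def A)
        show "(i, j) \<in> ?A \<and> (Suc i, j) \<in> ?A \<Longrightarrow> up F (Suc i) j < up F i j"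
          using D(4)[of i j] D(1)[of "Suc i" j] by (auto simp: up_def A)
      next
        fix x assume "x \<in> ?A"
        then show "case x of (i, j) \<Rightarrow> 0 < up F i j" using D(1) by (cases x) (force simp: up_def A)
      qed
      moreover have "low F \<in> ?L (dg F)"
        unfolding fillings_where_def shifted_fillings_def
      proof (intro CollectI conjI allI impI ballI)
        fix i j
        show "low F i i = list_shape (dg F) i"
          using ls_dg[OF F, of i] by (cases "(i, i) \<in> diagram q") (auto simp: up_def low_def A C)
        show "(i, j) \<notin> ?C \<Longrightarrow> low F i j = 0" by (simp add: low_def)
        \<comment> \<open>Transposition exchanges the two conditions: the strict columns of
          \<open>F\<close> absorb the added \<open>1\<close> along a row, and the loss of
          \<open>1\<close> down a column makes the weak rows of \<open>F\<close> strict.\<close>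
        show "(i, j) \<in> ?C \<and> (i, Suc j) \<in> ?C \<Longrightarrow> low F i (Suc j) \<le> low F i j"
          using D(4)[of j i] D(1)[of "Suc j" i] by (auto simp: low_def C)
        show "(i, j) \<in> ?C \<and> (Suc i, j) \<in> ?C \<Longrightarrow> low F (Suc i) j < low F i j"
          using D(3)[of j i] D(1)[of j "Suc i"] by (auto simp: low_def C)
      next
        fix x assume "x \<in> ?C"
        then show "case x of (i, j) \<Rightarrow> j - i < low F i j" using D(1) by (cases x) (force simp: low_def C)
      qed
      ultimately show "dg F \<in> ?X \<and> (up F, low F) \<in> ?U (dg F) \<times> ?L (dg F)" by simp
    qed
    have split: "U \<in> shifted_fillings (list_shape as) (list_shape xs)" "L \<in> shifted_fillings (list_shape cs) (list_shape xs)"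
      "\<And>i j. (i, j) \<in> ?A \<Longrightarrow> 0 < U i j \<and> U i j \<le> m"
      "\<And>i j. (i, j) \<in> ?C \<Longrightarrow> j - i < L i j \<and> L i j \<le> m"
      "\<And>i. U i i = L i i" "\<And>i. L i i = list_shape xs i"
      if "xs \<in> ?X" "U \<in> ?U xs" "L \<in> ?L xs" for xs U L
    proof -
      show U: "U \<in> shifted_fillings (list_shape as) (list_shape xs)"
        and L: "L \<in> shifted_fillings (list_shape cs) (list_shape xs)"
        using that by (auto simp: fillings_where_def)
      have xs: "list_shape xs i \<le> m" for i
        using decr_lists_nth[of xs m "i - 1"] that(1) by (auto simp: list_shape_def Suc_le_eq)
      show "0 < U i j \<and> U i j \<le> m" if "(i, j) \<in> ?A" for i j
        using shifted_fillings_le_diag[OF U that] xs[of i] \<open>U \<in> ?U xs\<close> that by (auto simp: fillings_where_def)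
      show "j - i < L i j \<and> L i j \<le> m" if "(i, j) \<in> ?C" for i j
        using shifted_fillings_le_diag[OF L that] xs[of i] \<open>L \<in> ?L xs\<close> that by (auto simp: fillings_where_def)
      show "U i i = L i i" "L i i = list_shape xs i" for i
        using shifted_fillings_diag[OF U] shifted_fillings_diag[OF L] by simp_all
    qed
    show "\<forall>a\<in>SIGMA xs:?X. ?U xs \<times> ?L xs.
      (\<lambda>F. (dg F, up F, low F)) ((\<lambda>(xs, U, L). glue U L) a) = a"
    proof
      fix a assume "a \<in> (SIGMA xs:?X. ?U xs \<times> ?L xs)"
      then obtain xs U L where a: "a = (xs, U, L)" "xs \<in> ?X" "U \<in> ?U xs" "L \<in> ?L xs" by auto
      note s = split[OF a(2-4)]
      have u: "up (glue U L) i j = U i j" for i j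
        using s(3)[of i j] shifted_fillings_out[OF s(1), of i j]
        by (cases "(i, j) \<in> ?A") (auto simp: up_def glue_def A)
      have l: "low (glue U L) i j = L i j" for i j
      proof (cases "(i, j) \<in> ?C")
        case True
        then show ?thesis using s(4)[OF True] s(5)[of i] by (auto simp: low_def glue_def C)
      next
        case False
        then show ?thesis using shifted_fillings_out[OF s(2), of i j] by (simp add: low_def)
      qed
      have "dg (glue U L) = xs"
      proof (rule nth_equalityI)
        show "length (dg (glue U L)) = length xs" using a(2) by (simp add: dg_def)
        fix i assume "i < length (dg (glue U L))"
        then have i: "i < length as" by (simp add: dg_def)
        then have "(Suc i, Suc i) \<in> diagram q" using Aii[of "Suc i"] A by simp
        then have "glue U L (Suc i) (Suc i) = Suc m - Suc (xs ! i)"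
          using s(5,6)[of "Suc i"] i a(2) by (simp add: glue_def list_shape_def)
        moreover have "xs ! i < m" using decr_lists_nth[of xs m i] a(2) i by simp
        ultimately show "dg (glue U L) ! i = xs ! i" using i by (simp add: dg_def)
      qed
      then show "(\<lambda>F. (dg F, up F, low F)) ((\<lambda>(xs, U, L). glue U L) a) = a"
        using a(1) u l by (simp add: fun_eq_iff)
    qed
    show "(\<lambda>(xs, U, L). glue U L) ` (SIGMA xs:?X. ?U xs \<times> ?L xs) \<subseteq> SSYT q m"
    proof clarify
      fix xs U L assume X: "xs \<in> decr_lists m" "length xs = length as" and a: "U \<in> ?U xs" "L \<in> ?L xs"
      have "xs \<in> ?X" using X by simp
      note s = split[OF this a]
      have gU: "glue U L i j = Suc m - U i j" "(i, j) \<in> ?A" "0 < U i j" "U i j \<le> m"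
        if "(i, j) \<in> diagram q" "i \<le> j" for i j
        using that s(3)[of i j] by (auto simp: glue_def A)
      have gL: "glue U L i j = Suc m + (i - j) - L j i" "(j, i) \<in> ?C" "i - j < L j i" "L j i \<le> m"
        if "(i, j) \<in> diagram q" "j \<le> i" for i j
        using that s(4)[of j i] s(5)[of i] by (auto simp: glue_def C)
      show "glue U L \<in> SSYT q m"
        unfolding SSYT_def
      proof (intro CollectI conjI allI impI)
        fix i j assume d: "(i, j) \<in> diagram q"
        have "1 \<le> glue U L i j \<and> glue U L i j \<le> m"
          using gU[OF d] gL[OF d] by (cases "i \<le> j") auto
        then show "1 \<le> glue U L i j" "glue U L i j \<le> m" by auto
      next
        fix i j assume "(i, j) \<notin> diagram q"
        then show "glue U L i j = 0" by (simp add: glue_def)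
      next
        fix i j assume d: "(i, j) \<in> diagram q \<and> (i, Suc j) \<in> diagram q"
        show "glue U L i j \<le> glue U L i (Suc j)"
        proof (cases "i \<le> j")
          case True
          then show ?thesis
            using d gU[of i j] gU[of i "Suc j"] shifted_fillings_row[OF s(1), of i j] by auto
        next
          case False
          then show ?thesis
            using d gL[of i j] gL[of i "Suc j"] shifted_fillings_column[OF s(2), of j i] by auto
        qed
      next
        fix i j assume d: "(i, j) \<in> diagram q \<and> (Suc i, j) \<in> diagram q"
        show "glue U L i j < glue U L (Suc i) j"
        proof (cases "j \<le> i")
          case True
          then show ?thesis
            using d gL[of i j] gL[of "Suc i" j] shifted_fillings_row[OF s(2), of j i] by auto
        next
          case False
          then show ?thesis
            using d gU[of i j] gU[of "Suc i" j] shifted_fillings_column[OF s(1), of i j] by auto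
        qed
      qed
    qed
  qed
  have fin: "finite (?U xs \<times> ?L xs)" if "xs \<in> ?X" for xs
    using that st finite_list_shape_fillings[of as xs] finite_list_shape_fillings[of cs xs]
    by (auto simp: fillings_where_def decr_lists_def)
  have "card (SSYT q m) = card (SIGMA xs:?X. ?U xs \<times> ?L xs)"
    by (rule bij_betw_same_card[OF bij, symmetric])
  also have "\<dots> = (\<Sum>xs\<in>?X. card (?U xs \<times> ?L xs))"
    by (rule card_SigmaI) (use fin finite_subset[OF _ finite_decr_lists[of m]] in auto)
  finally show ?thesis by (simp add: card_cartesian_product)
qed

section \<open>Pascal matrices\<close>

definition mprod :: "nat \<Rightarrow> (nat \<Rightarrow> nat \<Rightarrow> 'a::comm_ring_1) \<Rightarrow> (nat \<Rightarrow> nat \<Rightarrow> 'a) \<Rightarrow> nat \<Rightarrow> nat \<Rightarrow> 'a" where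
  "mprod n A B i j = (\<Sum>m<n. A i m * B m j)"

text \<open>Only rows below \<open>n\<close> are compared: lower triangular left factors make
  truncated sums exact there, for every column.\<close>

definition eq_rows :: "nat \<Rightarrow> (nat \<Rightarrow> nat \<Rightarrow> 'a) \<Rightarrow> (nat \<Rightarrow> nat \<Rightarrow> 'a) \<Rightarrow> bool" where
  "eq_rows n A B \<longleftrightarrow> (\<forall>i<n. \<forall>j. A i j = B i j)"

lemma eq_rows_refl [simp]: "eq_rows n A A"
  by (simp add: eq_rows_def)

lemma eq_rows_sym: "eq_rows n A B \<Longrightarrow> eq_rows n B A"
  by (simp add: eq_rows_def)

lemma eq_rows_trans [trans]: "eq_rows n A B \<Longrightarrow> eq_rows n B C \<Longrightarrow> eq_rows n A C"
  by (simp add: eq_rows_def)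

lemma eq_rows_mprod: "eq_rows n A A' \<Longrightarrow> eq_rows n B B' \<Longrightarrow> eq_rows n (mprod n A B) (mprod n A' B')"
  by (simp add: eq_rows_def mprod_def)

lemma mprod_assoc: "mprod n (mprod n A B) C = mprod n A (mprod n B C)"
proof (intro ext)
  fix i j
  have "mprod n (mprod n A B) C i j = (\<Sum>m<n. \<Sum>k<n. A i k * B k m * C m j)"
    by (simp add: mprod_def sum_distrib_right)
  also have "\<dots> = (\<Sum>k<n. \<Sum>m<n. A i k * B k m * C m j)" by (rule sum.swap)
  also have "\<dots> = mprod n A (mprod n B C) i j"
    by (simp add: mprod_def sum_distrib_left mult.assoc)
  finally show "mprod n (mprod n A B) C i j = mprod n A (mprod n B C) i j" .
qed

lemma minor_gf_eq_rows: "eq_rows n A B \<Longrightarrow> minor_gf n r A = minor_gf n r B"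
  by (rule minor_gf_cong) (simp add: eq_rows_def)

lemma minor_gf_mprod_commute: "minor_gf n r (mprod n A B) = minor_gf n r (mprod n B A)"
  using minor_gf_commute[of n r A B] by (simp add: mprod_def[abs_def])

text \<open>The formal power with exponent \<open>t\<close> of the Pascal matrix with offset
  \<open>k\<close>. For \<open>i < j\<close> the exponent \<open>i - j\<close> truncates, but then
  the binomial coefficient is \<open>0\<close>.\<close>

definition pascal :: "nat \<Rightarrow> 'a \<Rightarrow> nat \<Rightarrow> nat \<Rightarrow> 'a::comm_ring_1" where
  "pascal k t i j = of_nat ((i + k) choose (j + k)) * t ^ (i - j)"

abbreviation pascal_transpose :: "nat \<Rightarrow> nat \<Rightarrow> 'a::comm_ring_1" where
  "pascal_transpose \<equiv> \<lambda>i j. pascal 0 1 j i"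

text \<open>The lower triangular Toeplitz matrix of the coefficients of
  \<open>(1 + x)^k\<close>.\<close>

definition choose_shift :: "nat \<Rightarrow> nat \<Rightarrow> nat \<Rightarrow> 'a::comm_ring_1" where
  "choose_shift k i j = (if j \<le> i then of_nat (k choose (i - j)) else 0)"

lemma pascal_eq_0: "i < j \<Longrightarrow> pascal k t i j = 0"
  by (simp add: pascal_def binomial_eq_0)

text \<open>Taking \<open>(i + k) choose (l + k)\<close> out of the products of binomials leaves the
  expansion of \<open>(s + t)^(i - l)\<close>, so formal exponents add.\<close>

lemma mprod_pascal_pascal: "eq_rows n (mprod n (pascal k s) (pascal k t)) (pascal k (s + t))"
  unfolding eq_rows_def
proof (intro allI impI)
  fix i l assume i: "i < n"
  show "mprod n (pascal k s) (pascal k t) i l = pascal k (s + t) i l"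
  proof (cases "l \<le> i")
    case True
    have "mprod n (pascal k s) (pascal k t) i l = (\<Sum>j\<in>{l..i}. pascal k s i j * pascal k t j l)"
      unfolding mprod_def
      by (rule sum.mono_neutral_right) (use i in \<open>auto simp: pascal_eq_0 not_le\<close>)
    also have "\<dots> = (\<Sum>h\<le>i - l. pascal k s i (h + l) * pascal k t (h + l) l)"
      by (rule sum.reindex_bij_witness[of _ "\<lambda>h. h + l" "\<lambda>j. j - l"]) (use True in auto)
    also have "\<dots> = (\<Sum>h\<le>i - l. of_nat ((i + k) choose (l + k)) *
        (of_nat ((i - l) choose h) * t ^ h * s ^ (i - l - h)))"
    proof (rule sum.cong[OF refl])
      fix h assume "h \<in> {..i - l}"
      then have "((i + k) choose (h + l + k)) * ((h + l + k) choose (l + k)) =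
        ((i + k) choose (l + k)) * ((i - l) choose h)"
        using choose_mult[of "l + k" "h + l + k" "i + k"] True by simp
      then have "of_nat ((i + k) choose (h + l + k)) * of_nat ((h + l + k) choose (l + k)) =
        (of_nat ((i + k) choose (l + k)) * of_nat ((i - l) choose h) :: 'a)"
        by (metis of_nat_mult)
      then show "pascal k s i (h + l) * pascal k t (h + l) l = of_nat ((i + k) choose (l + k)) *
        (of_nat ((i - l) choose h) * t ^ h * s ^ (i - l - h))"
        by (simp add: pascal_def mult_ac add_ac)
    qed
    also have "\<dots> = pascal k (s + t) i l"
      by (simp add: pascal_def add.commute[of s] binomial_ring sum_distrib_left)
    finally show ?thesis .
  next
    case False
    then have "pascal k s i j * pascal k t j l = 0" for j
      by (cases "i < j") (auto simp: pascal_eq_0)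
    then show ?thesis using False by (simp add: mprod_def pascal_eq_0)
  qed
qed

text \<open>As \<open>0 ^ 0 = 1\<close>, the zeroth power is the identity. Hence
  \<open>pascal 0 (- 1)\<close> inverts \<open>pascal 0 1\<close> on the rows considered.\<close>

lemma mprod_pascal_0: "eq_rows n (mprod n (pascal 0 0) A) A"
proof -
  have "pascal 0 0 i m * A m j = (if m = i then A m j else 0)" for i j m
    by (cases "m < i"; cases "i < m") (auto simp: pascal_def binomial_eq_0 power_0_left)
  then show ?thesis by (simp add: eq_rows_def mprod_def)
qed

text \<open>Vandermonde's identity. One fixed right factor raises every offset by \<open>k\<close>,
  from \<open>0\<close> to \<open>k\<close> as well as from \<open>k\<close> to
  \<open>2 * k\<close>.\<close>

lemma mprod_pascal_choose_shift:
  "eq_rows n (mprod n (pascal i 1) (choose_shift k)) (pascal (i + k) (1 :: 'a::comm_ring_1))"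
  unfolding eq_rows_def
proof (intro allI impI)
  fix a s assume a: "a < n"
  show "mprod n (pascal i 1) (choose_shift k) a s = (pascal (i + k) 1 a s :: 'a)"
  proof (cases "s \<le> a")
    case True
    have "mprod n (pascal i 1) (choose_shift k) a s =
      (\<Sum>m\<in>{s..a}. pascal i 1 a m * choose_shift k m s :: 'a)"
      unfolding mprod_def
      by (rule sum.mono_neutral_right) (use a in \<open>auto simp: pascal_eq_0 choose_shift_def not_le\<close>)
    also have "\<dots> = (\<Sum>h\<le>a - s. of_nat ((k choose h) * ((a + i) choose (a - s - h))))"
    proof (rule sum.reindex_bij_witness[of _ "\<lambda>h. h + s" "\<lambda>m. m - s"])
      fix m assume m: "m \<in> {s..a}"
      then have "(a + i) choose (m + i) = (a + i) choose (a - m)"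
        using binomial_symmetric[of "m + i" "a + i"] by simp
      then show "of_nat ((k choose (m - s)) * ((a + i) choose (a - s - (m - s)))) =
        (pascal i 1 a m * choose_shift k m s :: 'a)"
        using m by (simp add: pascal_def choose_shift_def mult.commute)
    qed (use True in auto)
    also have "\<dots> = of_nat ((k + (a + i)) choose (a - s))"
      by (simp only: of_nat_sum[symmetric] vandermonde)
    also have "(k + (a + i)) choose (a - s) = (a + (i + k)) choose (s + (i + k))"
      using binomial_symmetric[of "a - s" "k + (a + i)"] True by (simp add: add_ac)
    finally show ?thesis by (simp only: pascal_def[of "i + k"] power_one mult_1_right)
  next
    case False
    then have "pascal i 1 a m * choose_shift k m s = (0 :: 'a)" for m
      by (cases "a < m") (auto simp: pascal_eq_0 choose_shift_def)
    then show ?thesis using False by (simp add: mprod_def pascal_eq_0)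
  qed
qed

text \<open>Vandermonde again. The entries on the right are the numbers from
  \<open>row_gf_positive\<close> with \<open>x\<close> shifted by \<open>k\<close>.\<close>

lemma mprod_pascal_transpose:
  "eq_rows n (mprod n (pascal k 1) pascal_transpose) (\<lambda>a x. of_nat ((x + k + a) choose a) :: 'a::comm_ring_1)"
  unfolding eq_rows_def
proof (intro allI impI)
  fix a x assume a: "a < n"
  have "mprod n (pascal k 1) pascal_transpose a x =
    (\<Sum>s\<le>a. pascal k 1 a s * pascal_transpose s x :: 'a)"
    unfolding mprod_def
    by (rule sum.mono_neutral_right) (use a in \<open>auto simp: pascal_eq_0 not_le\<close>)
  also have "\<dots> = (\<Sum>s\<le>a. of_nat ((x choose s) * ((a + k) choose (a - s))))"
  proof (rule sum.cong[OF refl])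
    fix s assume "s \<in> {..a}"
    then have "(a + k) choose (s + k) = (a + k) choose (a - s)"
      using binomial_symmetric[of "s + k" "a + k"] by simp
    then show "pascal k 1 a s * pascal_transpose s x =
      (of_nat ((x choose s) * ((a + k) choose (a - s))) :: 'a)"
      by (simp add: pascal_def mult.commute)
  qed
  also have "\<dots> = of_nat ((x + (a + k)) choose a)"
    by (simp only: of_nat_sum[symmetric] vandermonde)
  finally show "mprod n (pascal k 1) pascal_transpose a x = (of_nat ((x + k + a) choose a) :: 'a)"
    by (simp add: add_ac)
qed

text \<open>The matrix found from single rows is the transpose of this product, and principal minors
  ignore transposition.\<close>

lemma csspp_gf_eq_pascal:
  "csspp_gf n k r t = minor_gf n r (mprod n (pascal k t) pascal_transpose)"
proof -
  have "csspp_gf n k r t = minor_gf n r (\<lambda>i j. mprod n (pascal k t) pascal_transpose j i)"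
    unfolding csspp_gf_eq_minor_gf
  proof (rule minor_gf_cong)
    fix i j assume "i < n" "j < n"
    then have "mprod n (pascal k t) pascal_transpose j i = (\<Sum>d\<le>j. pascal k t j d * pascal_transpose d i)"
      unfolding mprod_def by (intro sum.mono_neutral_right) (auto simp: pascal_eq_0 not_le)
    then show "(\<Sum>d\<le>j. of_nat (i choose d) * of_nat ((k + j) choose (k + d)) * t ^ (j - d)) =
      mprod n (pascal k t) pascal_transpose j i"
      by (simp add: pascal_def mult_ac add_ac)
  qed
  then show ?thesis by (rule trans) (rule minor_gf_transpose)
qed

text \<open>For invertible \<open>t\<close> one would rescale rows and columns. In general each
  permutation is treated separately: either all differences are nonnegative and the exponents add up
  to \<open>sum_list bs - sum_list as\<close>, or a binomial coefficient vanishes on both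
  sides.\<close>

lemma minor_pascal_0:
  assumes "length bs = length as"
  shows "minor (pascal 0 t) bs as = t ^ (sum_list bs - sum_list as) * minor (\<lambda>b a. of_nat (b choose a)) bs as"
proof -
  let ?l = "length bs"
  have "(\<Prod>i = 0..<?l. pascal 0 t (bs ! i) (as ! p i)) =
    t ^ (sum_list bs - sum_list as) * (\<Prod>i = 0..<?l. of_nat ((bs ! i) choose (as ! p i)))"
    if p: "p permutes {0..<?l}" for p
  proof (cases "\<forall>i<?l. as ! p i \<le> bs ! i")
    case True
    have "sum_list as = (\<Sum>i = 0..<?l. as ! i)" using assms by (simp add: sum_list_sum_nth)
    also have "\<dots> = (\<Sum>i = 0..<?l. as ! p i)" by (rule sum.permute[OF p, unfolded o_def])
    finally have "(\<Sum>i = 0..<?l. bs ! i - as ! p i) = sum_list bs - sum_list as"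
      using True by (subst sum_subtractf_nat) (auto simp: sum_list_sum_nth)
    moreover have "(\<Prod>i = 0..<?l. pascal 0 t (bs ! i) (as ! p i)) =
      t ^ (\<Sum>i = 0..<?l. bs ! i - as ! p i) * (\<Prod>i = 0..<?l. of_nat ((bs ! i) choose (as ! p i)))"
      by (simp add: pascal_def prod.distrib power_sum mult.commute)
    ultimately show ?thesis by simp
  next
    case False
    then obtain i where i: "i \<in> {0..<?l}" "bs ! i < as ! p i" by (auto simp: not_le)
    have "(\<Prod>i = 0..<?l. pascal 0 t (bs ! i) (as ! p i)) = 0"
      by (rule prod_zero) (use i in \<open>auto intro!: bexI[of _ i] simp: pascal_eq_0\<close>)
    moreover have "(\<Prod>i = 0..<?l. of_nat ((bs ! i) choose (as ! p i))) = (0 :: 'a)"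
      by (rule prod_zero) (use i in \<open>auto intro!: bexI[of _ i] simp: binomial_eq_0\<close>)
    ultimately show ?thesis by simp
  qed
  then show ?thesis
    unfolding minor_def det_mat_expand sum_distrib_left
    by (intro sum.cong refl) (simp add: mult.left_commute)
qed

section \<open>Generating functions as sums of minors\<close>

lemma TSPP_frobenius_decr_lists:
  assumes T: "T \<in> TSPP m" and f: "frobenius (tspp_diag T) = (as, bs)"
  shows "as \<in> decr_lists m" "bs \<in> decr_lists m" "length as = length bs"
proof -
  note st = frobenius_strict[OF partition_tspp_diag[OF T] f]
  have le: "list_all2 (\<le>) as bs" by (rule TSPP_frobenius_le[OF T f])
  have b: "bs ! i < m" if "i < length bs" for i
  proof -
    have "Suc (bs ! i) = Suc (T (Suc i) (Suc i)) - Suc i"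
      using TSPP_list_shape(2)[OF T f, of "Suc i"] that by (simp add: list_shape_def)
    moreover have "T (Suc i) (Suc i) \<le> m" using T unfolding TSPP_def by blast
    ultimately show ?thesis by linarith
  qed
  then have "as ! i < m" if "i < length as" for i
    using le_less_trans[OF list_all2_nthD[OF le that] b[of i]] st(1) that by simp
  then show "as \<in> decr_lists m" "bs \<in> decr_lists m" "length as = length bs"
    using st b by (auto simp: decr_lists_def set_conv_nth)
qed

lemma schur_one: "schur p m (\<lambda>_. 1) = of_nat (card (SSYT p m))"
  by (simp add: schur_def case_prod_beta')

lemma tspp_weight_one:
  assumes T: "T \<in> TSPP m" and f: "frobenius (tspp_diag T) = (as, bs)"
  shows "tspp_weight N r 1 1 t T = r ^ length bs * t ^ (sum_list bs - sum_list as)"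
proof -
  have "list_all2 (\<le>) as bs" by (rule TSPP_frobenius_le[OF T f])
  then have "sum_list as \<le> sum_list bs \<and> (\<Sum>(a, b)\<leftarrow>zip as bs. b - a) = sum_list bs - sum_list as"
    by (induction rule: list_all2_induct) auto
  then show ?thesis
    using frobenius_strict(1)[OF partition_tspp_diag[OF T] f] by (simp add: tspp_weight_def f)
qed

text \<open>Upper and lower halves of tableaux with diagonal given by \<open>xs\<close> are counted
  by minors, and Cauchy-Binet sums their products over \<open>xs\<close>.\<close>

lemma card_SSYT_of_frobenius:
  assumes as: "as \<in> decr_lists n" and bs: "bs \<in> decr_lists n" and len: "length as = length bs"
  shows "of_nat (card (SSYT (of_frobenius as (map (\<lambda>b. b + k) bs)) (n + k))) =
    minor (mprod n (mprod n (pascal k 1) pascal_transpose) (pascal k (1 :: 'a::comm_ring_1))) as bs"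
proof -
  let ?cs = "map (\<lambda>b. b + k) bs"
  let ?X = "{xs. xs \<in> decr_lists (n + k) \<and> length xs = length as}"
  let ?U = "\<lambda>a x. of_nat ((x + a) choose a) :: 'a" and ?L = "\<lambda>x c. of_nat (x choose c) :: 'a"
  have s: "sorted_wrt (>) as" "sorted_wrt (>) ?cs" "length as = length ?cs"
    using as bs len by (auto simp: decr_lists_def sorted_wrt_map)
  note q = of_frobenius[OF s(3,1,2)]
  have "of_nat (card (SSYT (of_frobenius as ?cs) (n + k))) =
    (\<Sum>xs\<in>?X. of_nat (card (fillings_where (\<lambda>c e. 0 < e) (list_shape as) (list_shape xs))) *
      of_nat (card (fillings_where (<) (list_shape ?cs) (list_shape xs))) :: 'a)"
    by (simp add: card_SSYT_frobenius[OF q])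
  also have "\<dots> = (\<Sum>xs\<in>?X. minor ?U as xs * minor (\<lambda>x b. ?L x (b + k)) xs bs)"
  proof (rule sum.cong[OF refl])
    fix xs assume "xs \<in> ?X"
    then have xs: "sorted_wrt (>) xs" "length as = length xs" "length ?cs = length xs"
      using len by (auto simp: decr_lists_def)
    have "of_nat (card (fillings_where (\<lambda>c e. 0 < e) (list_shape as) (list_shape xs))) =
      minor (\<lambda>x a. ?U a x) xs as"
      by (rule card_positive_fillings[OF s(1) xs(1,2)])
    also have "\<dots> = minor ?U as xs" by (rule minor_transpose[OF xs(2)[symmetric]])
    finally have 1: "of_nat (card (fillings_where (\<lambda>c e. 0 < e) (list_shape as) (list_shape xs))) =
      minor ?U as xs" .
    have "of_nat (card (fillings_where (<) (list_shape ?cs) (list_shape xs))) = minor ?L xs ?cs"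
      by (rule card_offset_fillings[OF s(2) xs(1,3)])
    also have "\<dots> = minor (\<lambda>x b. ?L x (b + k)) xs bs"
      unfolding minor_def by (rule det_mat_cong) (use xs(3) in simp)
    finally show "of_nat (card (fillings_where (\<lambda>c e. 0 < e) (list_shape as) (list_shape xs))) *
      of_nat (card (fillings_where (<) (list_shape ?cs) (list_shape xs))) =
      minor ?U as xs * minor (\<lambda>x b. ?L x (b + k)) xs bs" using 1 by simp
  qed
  also have "\<dots> = minor (\<lambda>a b. \<Sum>x<n + k. ?U a x * ?L x (b + k)) as bs"
    by (rule Cauchy_Binet[OF len, symmetric])
  also have "\<dots> = minor (mprod n (mprod n (pascal k 1) pascal_transpose) (pascal k 1)) as bs"
  proof (rule minor_cong[OF _ len])
    fix a b assume "a \<in> set as"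
    then have a: "a < n" using as by (auto simp: decr_lists_def)
    \<comment> \<open>Middle indices below \<open>k\<close> contribute nothing, as
      \<open>x choose (b + k)\<close> is \<open>0\<close> there; shifting by \<open>k\<close> leaves
      \<open>n\<close> indices.\<close>
    have "(\<Sum>x<n + k. ?U a x * ?L x (b + k)) = (\<Sum>x\<in>{k..<n + k}. ?U a x * ?L x (b + k))"
      by (rule sum.mono_neutral_right) (auto simp: binomial_eq_0)
    also have "\<dots> = (\<Sum>x<n. ?U a (x + k) * ?L (x + k) (b + k))"
      by (rule sum.reindex_bij_witness[of _ "\<lambda>x. x + k" "\<lambda>x. x - k"]) auto
    also have "\<dots> = (\<Sum>x<n. mprod n (pascal k 1) pascal_transpose a x * pascal k 1 x b)"
      using mprod_pascal_transpose[of n k, where 'a = 'a] a by (simp add: eq_rows_def pascal_def[of k 1 _ b])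
    finally show "(\<Sum>x<n + k. ?U a x * ?L x (b + k)) =
      mprod n (mprod n (pascal k 1) pascal_transpose) (pascal k 1) a b"
      by (simp only: mprod_def[of n "mprod n (pascal k 1) pascal_transpose"])
  qed
  finally show ?thesis .
qed

text \<open>Grouping by the Frobenius coordinates of the diagonal gives products of two minors, one
  counting the TSPPs with powers of \<open>t\<close>, the other the tableaux. Cauchy-Binet over
  \<open>as\<close> leaves principal minors indexed by \<open>bs\<close>.\<close>

lemma tspp_gf_eq_minor_gf:
  fixes r t :: "'a::comm_ring_1"
  shows "tspp_gf (n + 1) k r 1 1 t (\<lambda>_. 1) = minor_gf n r
    (mprod n (pascal 0 t) (mprod n (mprod n (pascal k 1) pascal_transpose) (pascal k 1)))"
proof -
  let ?H = "mprod n (mprod n (pascal k 1) pascal_transpose) (pascal k 1) :: nat \<Rightarrow> nat \<Rightarrow> 'a"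
  let ?fr = "\<lambda>T. frobenius (tspp_diag T)"
  let ?w = "\<lambda>T. tspp_weight (n + 1) r 1 1 t T * schur (tspp_pi k T) (n + 1 + k - 1) (\<lambda>_. 1)"
  \<comment> \<open>The pairs are stored as \<open>(bs, as)\<close> so that the inner sum is over
    \<open>as\<close>.\<close>
  let ?S = "SIGMA bs:decr_lists n. {as \<in> decr_lists n. length as = length bs}"
  have img: "(\<lambda>T. prod.swap (?fr T)) ` TSPP n \<subseteq> ?S"
  proof (rule image_subsetI)
    fix T assume T: "T \<in> TSPP n"
    obtain as bs where f: "?fr T = (as, bs)" by (cases "?fr T")
    show "prod.swap (?fr T) \<in> ?S" using TSPP_frobenius_decr_lists[OF T f] f by simp
  qed
  have fS: "finite ?S" by (intro finite_SigmaI) (auto simp: finite_decr_lists)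
  have fiber: "(\<Sum>T | T \<in> TSPP n \<and> prod.swap (?fr T) = (bs, as). ?w T) =
    r ^ length bs * (minor (pascal 0 t) bs as * minor ?H as bs)"
    if bs: "bs \<in> decr_lists n" and as: "as \<in> decr_lists n" and len: "length as = length bs" for as bs
  proof -
    let ?c = "r ^ length bs * t ^ (sum_list bs - sum_list as) * minor ?H as bs"
    have "{T. T \<in> TSPP n \<and> prod.swap (?fr T) = (bs, as)} = {T \<in> TSPP n. ?fr T = (as, bs)}"
      by (auto simp: prod.swap_def prod_eq_iff)
    moreover have "?w T = ?c" if "T \<in> TSPP n" "?fr T = (as, bs)" for T
    proof -
      have "tspp_pi k T = of_frobenius as (map (\<lambda>b. b + k) bs)" using that by (simp add: tspp_pi_def)
      then show ?thesis
        by (simp add: tspp_weight_one[OF that] schur_one card_SSYT_of_frobenius[OF as bs len])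
    qed
    ultimately have "(\<Sum>T | T \<in> TSPP n \<and> prod.swap (?fr T) = (bs, as). ?w T) =
      of_nat (card {T \<in> TSPP n. ?fr T = (as, bs)}) * ?c" by simp
    also have "card {T \<in> TSPP n. ?fr T = (as, bs)} = card (fillings_where (<) (list_shape as) (list_shape bs))"
      by (rule card_TSPP_frobenius) (use as bs len in \<open>auto simp: decr_lists_def\<close>)
    also have "of_nat \<dots> = (minor (\<lambda>b a. of_nat (b choose a)) bs as :: 'a)"
      by (rule card_offset_fillings) (use as bs len in \<open>auto simp: decr_lists_def\<close>)
    finally show ?thesis
      by (simp add: minor_pascal_0[OF len[symmetric]] mult_ac)
  qed
  have "tspp_gf (n + 1) k r 1 1 t (\<lambda>_. 1) = (\<Sum>T\<in>TSPP n. ?w T)"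
    by (simp add: tspp_gf_def)
  also have "\<dots> = (\<Sum>x\<in>?S. \<Sum>T | T \<in> TSPP n \<and> prod.swap (?fr T) = x. ?w T)"
    by (rule sum.group[OF finite_TSPP fS img, symmetric])
  also have "\<dots> = (\<Sum>(bs, as)\<in>?S. r ^ length bs * (minor (pascal 0 t) bs as * minor ?H as bs))"
    by (rule sum.cong[OF refl]) (auto simp only: split_paired_all mem_Sigma_iff prod.case mem_Collect_eq fiber)
  also have "\<dots> = (\<Sum>bs\<in>decr_lists n. \<Sum>as | as \<in> decr_lists n \<and> length as = length bs.
      r ^ length bs * (minor (pascal 0 t) bs as * minor ?H as bs))"
    by (rule sum.Sigma[symmetric]) (auto simp: finite_decr_lists)
  also have "\<dots> = minor_gf n r (mprod n (pascal 0 t) ?H)"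
    unfolding minor_gf_def mprod_def[of n "pascal 0 t", abs_def]
    by (simp only: Cauchy_Binet[OF refl] sum_distrib_left)
  finally show ?thesis .
qed

theorem theorem2:
  fixes n k :: nat and r t :: "'a::comm_ring_1"
  assumes "n \<ge> 1"
  shows "tspp_gf (n + 1) 0 r 1 1 t (\<lambda>_. 1) = csspp_gf n 0 r (t + 2)
       \<and> tspp_gf (n + 1) k r 1 1 (-1) (\<lambda>_. 1) = csspp_gf n (2 * k) r 1
       \<and> tspp_gf (n + 1) k r 1 1 0 (\<lambda>_. 1) = csspp_gf n k r 2"
proof -
  let ?E = "pascal_transpose :: nat \<Rightarrow> nat \<Rightarrow> 'a"
  \<comment> \<open>The last factor \<open>pascal k 1\<close> is rotated to the front, so that
    \<open>?E\<close> stands last as on the CSSPP side.\<close>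
  have conj: "tspp_gf (n + 1) k r 1 1 t (\<lambda>_. 1) =
    minor_gf n r (mprod n (pascal k 1) (mprod n (pascal 0 t) (mprod n (pascal k 1) ?E)))" for k t
    unfolding tspp_gf_eq_minor_gf
    by (subst mprod_assoc[symmetric]) (rule minor_gf_mprod_commute)
  have "eq_rows n (mprod n (pascal 0 1) (mprod n (pascal 0 t) (mprod n (pascal 0 1) ?E)))
      (mprod n (pascal 0 (t + 2)) ?E)"
  proof -
    have "eq_rows n (mprod n (mprod n (pascal 0 1) (pascal 0 t)) (pascal 0 1)) (mprod n (pascal 0 (1 + t)) (pascal 0 1))"
      by (intro eq_rows_mprod mprod_pascal_pascal eq_rows_refl)
    also have "eq_rows n \<dots> (pascal 0 (1 + t + 1))" by (rule mprod_pascal_pascal)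
    also have "1 + t + 1 = t + 2" by simp
    finally have "eq_rows n (mprod n (mprod n (mprod n (pascal 0 1) (pascal 0 t)) (pascal 0 1)) ?E)
      (mprod n (pascal 0 (t + 2)) ?E)" by (rule eq_rows_mprod) simp
    then show ?thesis by (simp only: mprod_assoc)
  qed
  then have 1: "tspp_gf (n + 1) 0 r 1 1 t (\<lambda>_. 1) = csspp_gf n 0 r (t + 2)"
    unfolding conj csspp_gf_eq_pascal by (rule minor_gf_eq_rows)
  have "eq_rows n (mprod n (pascal k 1) (mprod n (pascal 0 (- 1)) (mprod n (pascal k 1) ?E)))
      (mprod n (pascal (2 * k) 1) ?E)"
  proof -
    let ?Z = "choose_shift k :: nat \<Rightarrow> nat \<Rightarrow> 'a"
    \<comment> \<open>Writing \<open>pascal k 1\<close> as \<open>pascal 0 1\<close> times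
      \<open>?Z\<close> gives the factor \<open>pascal 0 (- 1)\<close> its inverse to
      cancel.\<close>
    have Z: "eq_rows n (mprod n (pascal 0 1) ?Z) (pascal k 1)"
      using mprod_pascal_choose_shift[of n 0 k, where 'a = 'a] by simp
    have "eq_rows n (mprod n (pascal 0 (- 1)) (mprod n (pascal k 1) ?E))
      (mprod n (pascal 0 (- 1)) (mprod n (mprod n (pascal 0 1) ?Z) ?E))"
      by (intro eq_rows_mprod eq_rows_sym[OF Z] eq_rows_refl)
    also have "\<dots> = mprod n (mprod n (pascal 0 (- 1)) (pascal 0 1)) (mprod n ?Z ?E)"
      by (simp only: mprod_assoc)
    also have "eq_rows n \<dots> (mprod n (pascal 0 (- 1 + 1)) (mprod n ?Z ?E))"
      by (intro eq_rows_mprod mprod_pascal_pascal eq_rows_refl)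
    also have "- 1 + 1 = (0 :: 'a)" by simp
    also have "eq_rows n (mprod n (pascal 0 0) (mprod n ?Z ?E)) (mprod n ?Z ?E)"
      by (rule mprod_pascal_0)
    finally have "eq_rows n (mprod n (pascal k 1) (mprod n (pascal 0 (- 1)) (mprod n (pascal k 1) ?E)))
      (mprod n (pascal k 1) (mprod n ?Z ?E))"
      by (rule eq_rows_mprod[OF eq_rows_refl])
    also have "\<dots> = mprod n (mprod n (pascal k 1) ?Z) ?E" by (rule mprod_assoc[symmetric])
    also have "eq_rows n \<dots> (mprod n (pascal (k + k) 1) ?E)"
      by (intro eq_rows_mprod mprod_pascal_choose_shift eq_rows_refl)
    finally show ?thesis by (simp only: mult_2)
  qed
  then have 2: "tspp_gf (n + 1) k r 1 1 (- 1) (\<lambda>_. 1) = csspp_gf n (2 * k) r 1"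
    unfolding conj csspp_gf_eq_pascal by (rule minor_gf_eq_rows)
  \<comment> \<open>For \<open>t = 0\<close> the middle factor is the identity, and the two
    remaining exponents add up to \<open>2\<close>.\<close>
  have "eq_rows n (mprod n (pascal k 1) (mprod n (pascal 0 0) (mprod n (pascal k 1) ?E)))
      (mprod n (pascal k 2) ?E)"
  proof -
    have "eq_rows n (mprod n (pascal k 1) (mprod n (pascal 0 0) (mprod n (pascal k 1) ?E)))
      (mprod n (pascal k 1) (mprod n (pascal k 1) ?E))"
      by (intro eq_rows_mprod mprod_pascal_0 eq_rows_refl)
    also have "\<dots> = mprod n (mprod n (pascal k 1) (pascal k 1)) ?E" by (rule mprod_assoc[symmetric])
    also have "eq_rows n \<dots> (mprod n (pascal k (1 + 1)) ?E)"
      by (intro eq_rows_mprod mprod_pascal_pascal eq_rows_refl)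
    also have "1 + 1 = (2 :: 'a)" by simp
    finally show ?thesis .
  qed
  then have 3: "tspp_gf (n + 1) k r 1 1 0 (\<lambda>_. 1) = csspp_gf n k r 2"
    unfolding conj csspp_gf_eq_pascal by (rule minor_gf_eq_rows)
  show ?thesis using 1 2 3 by blast
qed

end
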